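(* Let $T:\mathcal A\to\mathsf{Mnd}(\mathcal X)$ be a parametrized monad. Then the forgetful functor $$\mathcal A\ltimes^T\mathcal X\longrightarrow\mathcal A\times\mathcal X,\qquad (A,X,\xi)\mapsto(A,X)$$ is monadic, and therefore it creates limits.
   Context: A parametrized monad with parameters $\mathcal A$ and carriers $\mathcal X$ is a functor $T:\mathcal A\to\mathsf{Mnd}(\mathcal X)$, $A\mapsto T_A$, into the category of monads on $\mathcal X$ and monad morphisms (natural transformations compatible with units and multiplications). $\mathcal A\ltimes^T\mathcal X$ is the category with objects $(A,X,\xi)$, where $A\in\mathcal A$ and $\xi:T_AX\to X$ is an Eilenberg--Moore algebra of $T_A$, and morphisms $(A,X,\xi)\to(B,Y,\theta)$ the pairs $(f:A\to B,\ g:X\to Y)$ with $g\circ\xi=\theta\circ T(f,g)$, where $T(f,g):T_AX\to T_BY$. *)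

theory Defs
  imports "HOL-Library.FuncSet"
begin

section \<open>Categories, functors, natural transformations\<close>

text \<open>Composition is written in the usual order: \<open>g \<cdot> f\<close> is \<open>f\<close> followed by \<open>g\<close>.  The fields
  are only meaningful on \<open>Obj\<close>, on \<open>Arr\<close> and on composable pairs.\<close>

record ('o, 'a) cat =
  Obj :: "'o set"
  Arr :: "'a set"
  Dom :: "'a \<Rightarrow> 'o"
  Cod :: "'a \<Rightarrow> 'o"
  Ide :: "'o \<Rightarrow> 'a"
  Comp :: "'a \<Rightarrow> 'a \<Rightarrow> 'a" (infixr "\<cdot>\<index>" 70)

definition hom :: "('o, 'a) cat \<Rightarrow> 'o \<Rightarrow> 'o \<Rightarrow> 'a set" where
  "hom C X Y = {f \<in> Arr C. Dom C f = X \<and> Cod C f = Y}"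

locale category =
  fixes C :: "('o, 'a) cat" (structure)
  assumes Dom_in_Obj: "f \<in> Arr C \<Longrightarrow> Dom C f \<in> Obj C"
    and Cod_in_Obj: "f \<in> Arr C \<Longrightarrow> Cod C f \<in> Obj C"
    and Ide_in_hom: "X \<in> Obj C \<Longrightarrow> Ide C X \<in> hom C X X"
    and Comp_in_hom: "\<lbrakk>f \<in> hom C X Y; g \<in> hom C Y Z\<rbrakk> \<Longrightarrow> g \<cdot> f \<in> hom C X Z"
    and Comp_Ide_right: "f \<in> hom C X Y \<Longrightarrow> f \<cdot> Ide C X = f"
    and Comp_Ide_left: "f \<in> hom C X Y \<Longrightarrow> Ide C Y \<cdot> f = f"
    and Comp_assoc: "\<lbrakk>f \<in> hom C W X; g \<in> hom C X Y; h \<in> hom C Y Z\<rbrakk>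
      \<Longrightarrow> (h \<cdot> g) \<cdot> f = h \<cdot> (g \<cdot> f)"

text \<open>Functors, natural transformations and cones are represented by functions that are
  \<open>undefined\<close> outside their domain, so that HOL equality is equality in the usual sense.\<close>

record ('o1, 'a1, 'o2, 'a2) func =
  fobj :: "'o1 \<Rightarrow> 'o2"
  farr :: "'a1 \<Rightarrow> 'a2"

definition is_functor ::
  "('o1, 'a1) cat \<Rightarrow> ('o2, 'a2) cat \<Rightarrow> ('o1, 'a1, 'o2, 'a2) func \<Rightarrow> bool" where
  "is_functor C D F \<longleftrightarrow>
     category C \<and> category D \<and>
     fobj F \<in> Obj C \<rightarrow>\<^sub>E Obj D \<and>
     farr F \<in> Arr C \<rightarrow>\<^sub>E Arr D \<and>
     (\<forall>f \<in> Arr C. farr F f \<in> hom D (fobj F (Dom C f)) (fobj F (Cod C f))) \<and>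
     (\<forall>X \<in> Obj C. farr F (Ide C X) = Ide D (fobj F X)) \<and>
     (\<forall>f \<in> Arr C. \<forall>g \<in> Arr C. Cod C f = Dom C g \<longrightarrow>
        farr F (g \<cdot>\<^bsub>C\<^esub> f) = farr F g \<cdot>\<^bsub>D\<^esub> farr F f)"

definition id_func :: "('o, 'a) cat \<Rightarrow> ('o, 'a, 'o, 'a) func" where
  "id_func C = \<lparr>fobj = (\<lambda>X \<in> Obj C. X), farr = (\<lambda>f \<in> Arr C. f)\<rparr>"

definition comp_func :: "('o1, 'a1) cat \<Rightarrow> ('o2, 'a2, 'o3, 'a3) func \<Rightarrow>
    ('o1, 'a1, 'o2, 'a2) func \<Rightarrow> ('o1, 'a1, 'o3, 'a3) func" where
  "comp_func C G F =
     \<lparr>fobj = (\<lambda>X \<in> Obj C. fobj G (fobj F X)), farr = (\<lambda>f \<in> Arr C. farr G (farr F f))\<rparr>"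

definition is_iso_functor ::
  "('o1, 'a1) cat \<Rightarrow> ('o2, 'a2) cat \<Rightarrow> ('o1, 'a1, 'o2, 'a2) func \<Rightarrow> bool" where
  "is_iso_functor C D K \<longleftrightarrow> is_functor C D K \<and>
     (\<exists>L. is_functor D C L \<and> comp_func C L K = id_func C \<and> comp_func D K L = id_func D)"

definition nat_trans :: "('o1, 'a1) cat \<Rightarrow> ('o2, 'a2) cat \<Rightarrow> ('o1, 'a1, 'o2, 'a2) func \<Rightarrow>
    ('o1, 'a1, 'o2, 'a2) func \<Rightarrow> ('o1 \<Rightarrow> 'a2) \<Rightarrow> bool" where
  "nat_trans C D F G \<tau> \<longleftrightarrow>
     is_functor C D F \<and> is_functor C D G \<and>
     \<tau> \<in> extensional (Obj C) \<and>
     (\<forall>X \<in> Obj C. \<tau> X \<in> hom D (fobj F X) (fobj G X)) \<and>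
     (\<forall>f \<in> Arr C. farr G f \<cdot>\<^bsub>D\<^esub> \<tau> (Dom C f) = \<tau> (Cod C f) \<cdot>\<^bsub>D\<^esub> farr F f)"

definition prod_cat ::
  "('o1, 'a1) cat \<Rightarrow> ('o2, 'a2) cat \<Rightarrow> ('o1 \<times> 'o2, 'a1 \<times> 'a2) cat" where
  "prod_cat C D =
     \<lparr>Obj = Obj C \<times> Obj D, Arr = Arr C \<times> Arr D,
      Dom = (\<lambda>(f, g). (Dom C f, Dom D g)), Cod = (\<lambda>(f, g). (Cod C f, Cod D g)),
      Ide = (\<lambda>(X, Y). (Ide C X, Ide D Y)),
      Comp = (\<lambda>(f', g') (f, g). (f' \<cdot>\<^bsub>C\<^esub> f, g' \<cdot>\<^bsub>D\<^esub> g))\<rparr>"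


section \<open>Monads and their algebras\<close>

record ('o, 'a) monad =
  endo :: "('o, 'a, 'o, 'a) func"
  eta :: "'o \<Rightarrow> 'a"
  mu :: "'o \<Rightarrow> 'a"

definition is_monad :: "('o, 'a) cat \<Rightarrow> ('o, 'a) monad \<Rightarrow> bool" where
  "is_monad C M \<longleftrightarrow>
     nat_trans C C (id_func C) (endo M) (eta M) \<and>
     nat_trans C C (comp_func C (endo M) (endo M)) (endo M) (mu M) \<and>
     (\<forall>X \<in> Obj C. mu M X \<cdot>\<^bsub>C\<^esub> farr (endo M) (eta M X) = Ide C (fobj (endo M) X)) \<and>
     (\<forall>X \<in> Obj C. mu M X \<cdot>\<^bsub>C\<^esub> eta M (fobj (endo M) X) = Ide C (fobj (endo M) X)) \<and>
     (\<forall>X \<in> Obj C. mu M X \<cdot>\<^bsub>C\<^esub> farr (endo M) (mu M X) =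
        mu M X \<cdot>\<^bsub>C\<^esub> mu M (fobj (endo M) X))"

definition monad_morphism ::
  "('o, 'a) cat \<Rightarrow> ('o, 'a) monad \<Rightarrow> ('o, 'a) monad \<Rightarrow> ('o \<Rightarrow> 'a) \<Rightarrow> bool" where
  "monad_morphism C M N \<tau> \<longleftrightarrow>
     is_monad C M \<and> is_monad C N \<and>
     nat_trans C C (endo M) (endo N) \<tau> \<and>
     (\<forall>X \<in> Obj C. \<tau> X \<cdot>\<^bsub>C\<^esub> eta M X = eta N X) \<and>
     (\<forall>X \<in> Obj C. \<tau> X \<cdot>\<^bsub>C\<^esub> mu M X =
        mu N X \<cdot>\<^bsub>C\<^esub> (farr (endo N) (\<tau> X) \<cdot>\<^bsub>C\<^esub> \<tau> (fobj (endo M) X)))"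

text \<open>In this and the following categories an arrow carries its source and target, because the
  underlying data (here the family \<open>\<tau>\<close>) does not determine them.\<close>

definition Mnd :: "('o, 'a) cat \<Rightarrow>
    (('o, 'a) monad, ('o, 'a) monad \<times> ('o \<Rightarrow> 'a) \<times> ('o, 'a) monad) cat" where
  "Mnd C =
     \<lparr>Obj = {M. is_monad C M},
      Arr = {(M, \<tau>, N). monad_morphism C M N \<tau>},
      Dom = (\<lambda>(M, \<tau>, N). M), Cod = (\<lambda>(M, \<tau>, N). N),
      Ide = (\<lambda>M. (M, \<lambda>X \<in> Obj C. Ide C (fobj (endo M) X), M)),
      Comp = (\<lambda>(M', \<sigma>, N') (M, \<tau>, N). (M, \<lambda>X \<in> Obj C. \<sigma> X \<cdot>\<^bsub>C\<^esub> \<tau> X, N'))\<rparr>"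

definition em_algebra :: "('o, 'a) cat \<Rightarrow> ('o, 'a) monad \<Rightarrow> 'o \<Rightarrow> 'a \<Rightarrow> bool" where
  "em_algebra C M X \<xi> \<longleftrightarrow>
     X \<in> Obj C \<and> \<xi> \<in> hom C (fobj (endo M) X) X \<and>
     \<xi> \<cdot>\<^bsub>C\<^esub> eta M X = Ide C X \<and>
     \<xi> \<cdot>\<^bsub>C\<^esub> farr (endo M) \<xi> = \<xi> \<cdot>\<^bsub>C\<^esub> mu M X"

definition em_cat ::
  "('o, 'a) cat \<Rightarrow> ('o, 'a) monad \<Rightarrow> ('o \<times> 'a, ('o \<times> 'a) \<times> 'a \<times> ('o \<times> 'a)) cat" where
  "em_cat C M =
     \<lparr>Obj = {(X, \<xi>). em_algebra C M X \<xi>},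
      Arr = {((X, \<xi>), g, (Y, \<theta>)). em_algebra C M X \<xi> \<and> em_algebra C M Y \<theta> \<and>
               g \<in> hom C X Y \<and> g \<cdot>\<^bsub>C\<^esub> \<xi> = \<theta> \<cdot>\<^bsub>C\<^esub> farr (endo M) g},
      Dom = (\<lambda>(s, g, t). s), Cod = (\<lambda>(s, g, t). t),
      Ide = (\<lambda>(X, \<xi>). ((X, \<xi>), Ide C X, (X, \<xi>))),
      Comp = (\<lambda>(s', g', t') (s, g, t). (s, g' \<cdot>\<^bsub>C\<^esub> g, t'))\<rparr>"


section \<open>Monadic functors\<close>

text \<open>\<open>F : D \<rightarrow> C\<close> is left adjoint to \<open>U : C \<rightarrow> D\<close>, with unit \<open>\<eta>\<close> and counit \<open>\<epsilon>\<close>.\<close>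

definition adjunction :: "('oc, 'ac) cat \<Rightarrow> ('od, 'ad) cat \<Rightarrow> ('od, 'ad, 'oc, 'ac) func \<Rightarrow>
    ('oc, 'ac, 'od, 'ad) func \<Rightarrow> ('od \<Rightarrow> 'ad) \<Rightarrow> ('oc \<Rightarrow> 'ac) \<Rightarrow> bool" where
  "adjunction C D F U \<eta> \<epsilon> \<longleftrightarrow>
     is_functor D C F \<and> is_functor C D U \<and>
     nat_trans D D (id_func D) (comp_func D U F) \<eta> \<and>
     nat_trans C C (comp_func C F U) (id_func C) \<epsilon> \<and>
     (\<forall>X \<in> Obj D. \<epsilon> (fobj F X) \<cdot>\<^bsub>C\<^esub> farr F (\<eta> X) = Ide C (fobj F X)) \<and>
     (\<forall>Y \<in> Obj C. farr U (\<epsilon> Y) \<cdot>\<^bsub>D\<^esub> \<eta> (fobj U Y) = Ide D (fobj U Y))"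

definition induced_monad :: "('od, 'ad) cat \<Rightarrow> ('od, 'ad, 'oc, 'ac) func \<Rightarrow>
    ('oc, 'ac, 'od, 'ad) func \<Rightarrow> ('od \<Rightarrow> 'ad) \<Rightarrow> ('oc \<Rightarrow> 'ac) \<Rightarrow> ('od, 'ad) monad" where
  "induced_monad D F U \<eta> \<epsilon> =
     \<lparr>endo = comp_func D U F, eta = \<eta>, mu = (\<lambda>X \<in> Obj D. farr U (\<epsilon> (fobj F X)))\<rparr>"

definition comparison :: "('oc, 'ac) cat \<Rightarrow> ('oc, 'ac, 'od, 'ad) func \<Rightarrow> ('oc \<Rightarrow> 'ac) \<Rightarrow>
    ('oc, 'ac, 'od \<times> 'ad, ('od \<times> 'ad) \<times> 'ad \<times> ('od \<times> 'ad)) func" where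
  "comparison C U \<epsilon> =
     \<lparr>fobj = (\<lambda>Y \<in> Obj C. (fobj U Y, farr U (\<epsilon> Y))),
      farr = (\<lambda>f \<in> Arr C. ((fobj U (Dom C f), farr U (\<epsilon> (Dom C f))), farr U f,
                           (fobj U (Cod C f), farr U (\<epsilon> (Cod C f)))))\<rparr>"

text \<open>Mac Lane's convention: the comparison functor to Eilenberg--Moore algebras is required to be
  an isomorphism, not merely an equivalence, of categories.  It goes with the notion of creation of
  limits below: it is in this sense that a monadic functor creates limits on the nose.\<close>

definition monadic ::
  "('oc, 'ac) cat \<Rightarrow> ('od, 'ad) cat \<Rightarrow> ('oc, 'ac, 'od, 'ad) func \<Rightarrow> bool" where
  "monadic C D U \<longleftrightarrow>
     (\<exists>F \<eta> \<epsilon>. adjunction C D F U \<eta> \<epsilon> \<and>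
        is_iso_functor C (em_cat D (induced_monad D F U \<eta> \<epsilon>)) (comparison C U \<epsilon>))"


section \<open>Limits and their creation\<close>

definition is_cone :: "('j, 'k) cat \<Rightarrow> ('o, 'a) cat \<Rightarrow> ('j, 'k, 'o, 'a) func \<Rightarrow>
    'o \<Rightarrow> ('j \<Rightarrow> 'a) \<Rightarrow> bool" where
  "is_cone J C F c \<sigma> \<longleftrightarrow>
     c \<in> Obj C \<and> \<sigma> \<in> extensional (Obj J) \<and>
     (\<forall>j \<in> Obj J. \<sigma> j \<in> hom C c (fobj F j)) \<and>
     (\<forall>u \<in> Arr J. farr F u \<cdot>\<^bsub>C\<^esub> \<sigma> (Dom J u) = \<sigma> (Cod J u))"

definition is_limit :: "('j, 'k) cat \<Rightarrow> ('o, 'a) cat \<Rightarrow> ('j, 'k, 'o, 'a) func \<Rightarrow>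
    'o \<Rightarrow> ('j \<Rightarrow> 'a) \<Rightarrow> bool" where
  "is_limit J C F c \<sigma> \<longleftrightarrow>
     is_cone J C F c \<sigma> \<and>
     (\<forall>c' \<sigma>'. is_cone J C F c' \<sigma>' \<longrightarrow>
        (\<exists>!h. h \<in> hom C c' c \<and> (\<forall>j \<in> Obj J. \<sigma> j \<cdot>\<^bsub>C\<^esub> h = \<sigma>' j)))"

definition lifts_cone :: "('j, 'k) cat \<Rightarrow> ('oc, 'ac) cat \<Rightarrow> ('oc, 'ac, 'od, 'ad) func \<Rightarrow>
    ('j, 'k, 'oc, 'ac) func \<Rightarrow> 'od \<Rightarrow> ('j \<Rightarrow> 'ad) \<Rightarrow> 'oc \<Rightarrow> ('j \<Rightarrow> 'ac) \<Rightarrow> bool" where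
  "lifts_cone J C U F x \<tau> c \<sigma> \<longleftrightarrow>
     is_cone J C F c \<sigma> \<and> fobj U c = x \<and> (\<forall>j \<in> Obj J. farr U (\<sigma> j) = \<tau> j)"

text \<open>Creation of limits in the strict sense of Mac Lane: every limit cone over \<open>U \<circ> F\<close> has
  exactly one lift to a cone over \<open>F\<close>, and that lift is a limit cone.\<close>

definition creates_limits_of_shape :: "('j, 'k) cat \<Rightarrow> ('oc, 'ac) cat \<Rightarrow> ('od, 'ad) cat \<Rightarrow>
    ('oc, 'ac, 'od, 'ad) func \<Rightarrow> bool" where
  "creates_limits_of_shape J C D U \<longleftrightarrow>
     (\<forall>F. is_functor J C F \<longrightarrow>
       (\<forall>x \<tau>. is_limit J D (comp_func J U F) x \<tau> \<longrightarrow>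
          (\<exists>!(c, \<sigma>). lifts_cone J C U F x \<tau> c \<sigma>) \<and>
          (\<forall>c \<sigma>. lifts_cone J C U F x \<tau> c \<sigma> \<longrightarrow> is_limit J C F c \<sigma>)))"


section \<open>Parametrized monads\<close>

type_synonym ('ao, 'aa, 'xo, 'xa) pmonad =
  "('ao, 'aa, ('xo, 'xa) monad, ('xo, 'xa) monad \<times> ('xo \<Rightarrow> 'xa) \<times> ('xo, 'xa) monad) func"

definition parametrized_monad ::
  "('ao, 'aa) cat \<Rightarrow> ('xo, 'xa) cat \<Rightarrow> ('ao, 'aa, 'xo, 'xa) pmonad \<Rightarrow> bool" where
  "parametrized_monad \<A> \<X> T \<longleftrightarrow> category \<A> \<and> category \<X> \<and> is_functor \<A> (Mnd \<X>) T"

text \<open>The component at \<open>X\<close> of the monad morphism \<open>T\<^sub>f\<close>.\<close>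

definition pcomponent :: "('ao, 'aa, 'xo, 'xa) pmonad \<Rightarrow> 'aa \<Rightarrow> 'xo \<Rightarrow> 'xa" where
  "pcomponent T f X = fst (snd (farr T f)) X"

text \<open>\<open>T(f, g) : T\<^sub>A X \<rightarrow> T\<^sub>B Y\<close> is the action on arrows of the functor \<open>\<A> \<times> \<X> \<rightarrow> \<X>\<close>
  corresponding to \<open>T\<close>, for \<open>f : A \<rightarrow> B\<close> and \<open>g : X \<rightarrow> Y\<close>; by naturality of \<open>T\<^sub>f\<close> it
  equals \<open>T\<^sub>B g \<cdot> (T\<^sub>f)\<^sub>X\<close> as well.\<close>

definition pmap :: "('ao, 'aa) cat \<Rightarrow> ('xo, 'xa) cat \<Rightarrow> ('ao, 'aa, 'xo, 'xa) pmonad \<Rightarrow>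
    'aa \<Rightarrow> 'xa \<Rightarrow> 'xa" where
  "pmap \<A> \<X> T f g =
     pcomponent T f (Cod \<X> g) \<cdot>\<^bsub>\<X>\<^esub> farr (endo (fobj T (Dom \<A> f))) g"

definition semidirect :: "('ao, 'aa) cat \<Rightarrow> ('xo, 'xa) cat \<Rightarrow> ('ao, 'aa, 'xo, 'xa) pmonad \<Rightarrow>
    ('ao \<times> 'xo \<times> 'xa,
     ('ao \<times> 'xo \<times> 'xa) \<times> ('aa \<times> 'xa) \<times> ('ao \<times> 'xo \<times> 'xa)) cat" where
  "semidirect \<A> \<X> T =
     \<lparr>Obj = {(A, X, \<xi>). A \<in> Obj \<A> \<and> em_algebra \<X> (fobj T A) X \<xi>},
      Arr = {((A, X, \<xi>), (f, g), (B, Y, \<theta>)).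
               A \<in> Obj \<A> \<and> em_algebra \<X> (fobj T A) X \<xi> \<and>
               B \<in> Obj \<A> \<and> em_algebra \<X> (fobj T B) Y \<theta> \<and>
               f \<in> hom \<A> A B \<and> g \<in> hom \<X> X Y \<and>
               g \<cdot>\<^bsub>\<X>\<^esub> \<xi> = \<theta> \<cdot>\<^bsub>\<X>\<^esub> pmap \<A> \<X> T f g},
      Dom = (\<lambda>(s, fg, t). s), Cod = (\<lambda>(s, fg, t). t),
      Ide = (\<lambda>(A, X, \<xi>). ((A, X, \<xi>), (Ide \<A> A, Ide \<X> X), (A, X, \<xi>))),
      Comp = (\<lambda>(s', (f', g'), t') (s, (f, g), t). (s, (f' \<cdot>\<^bsub>\<A>\<^esub> f, g' \<cdot>\<^bsub>\<X>\<^esub> g), t'))\<rparr>"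

definition forgetful :: "('ao, 'aa) cat \<Rightarrow> ('xo, 'xa) cat \<Rightarrow> ('ao, 'aa, 'xo, 'xa) pmonad \<Rightarrow>
    ('ao \<times> 'xo \<times> 'xa,
     ('ao \<times> 'xo \<times> 'xa) \<times> ('aa \<times> 'xa) \<times> ('ao \<times> 'xo \<times> 'xa),
     'ao \<times> 'xo, 'aa \<times> 'xa) func" where
  "forgetful \<A> \<X> T =
     \<lparr>fobj = (\<lambda>(A, X, \<xi>) \<in> Obj (semidirect \<A> \<X> T). (A, X)),
      farr = (\<lambda>(s, fg, t) \<in> Arr (semidirect \<A> \<X> T). fg)\<rparr>"

end

theory Submission
  imports Defs
begin

text \<open>The units and multiplications of the monads \<open>T\<^sub>A\<close> are natural in \<open>A\<close> as well as in \<open>X\<close>,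
  because every \<open>T\<^sub>f\<close> is a morphism of monads (\<open>T_map_unit\<close>, \<open>T_map_mult\<close>).  Hence
  \<open>(A, X) \<mapsto> (A, T\<^sub>A X)\<close> is a monad on \<open>\<A> \<times> \<X>\<close>, with the identity as unit and
  multiplication in the first variable.  By the unit law an algebra structure \<open>(a, \<xi>)\<close> on
  \<open>(A, X)\<close> has \<open>a = id\<close>, so it is nothing but an algebra \<open>\<xi>\<close> of \<open>T\<^sub>A\<close> on \<open>X\<close>, and a morphism
  of algebras is a pair \<open>(f, g)\<close> with \<open>g \<cdot> \<xi> = \<theta> \<cdot> T(f, g)\<close>.  Thus \<open>\<A> \<ltimes> \<X>\<close> is the
  category of algebras of this monad.

  Monadicity speaks of an adjunction whose comparison functor is an isomorphism.  The adjunction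
  is \<open>adjunction_free_forgetful\<close>: the left adjoint sends \<open>(A, X)\<close> to the free algebra
  \<open>(A, T\<^sub>A X, \<mu>)\<close>, and the counit at \<open>(A, X, \<xi>)\<close> is \<open>(id, \<xi>)\<close>.  The description of the
  algebras just given makes the comparison functor bijective on objects and on arrows
  (\<open>iso_comparison\<close>), which suffices by \<open>is_iso_functor_iff_bij_betw\<close>.

  Creation of limits holds for every monadic functor (\<open>monadic_creates_limits\<close>).  The legs
  of a limit cone in the base category are jointly monic, and the structure maps of the algebras in
  the diagram induce exactly one structure map on the vertex for which the legs are morphisms; the
  algebra laws for it, and the compatibility of induced arrows with it, are equations that can be
  tested on the legs.\<close>


section \<open>Categories and functors in terms of domains and codomains\<close>

text \<open>Membership in a hom-set is replaced by conditions on \<open>Dom\<close> and \<open>Cod\<close>, because equations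
  between domains and codomains are something that the simplifier can compute with: it discharges
  the typing conditions of associativity and functoriality without being told the objects.\<close>

context category
begin

lemma Obj_Dom [simp]: "f \<in> Arr C \<Longrightarrow> Dom C f \<in> Obj C"
  by (rule Dom_in_Obj)

lemma Obj_Cod [simp]: "f \<in> Arr C \<Longrightarrow> Cod C f \<in> Obj C"
  by (rule Cod_in_Obj)

lemma Ide_simps [simp]:
  assumes "X \<in> Obj C"
  shows "Ide C X \<in> Arr C" "Dom C (Ide C X) = X" "Cod C (Ide C X) = X"
  using Ide_in_hom[OF assms] by (auto simp: hom_def)

lemma Comp_simps [simp]:
  assumes "f \<in> Arr C" "g \<in> Arr C" "Cod C f = Dom C g"
  shows "g \<cdot> f \<in> Arr C" "Dom C (g \<cdot> f) = Dom C f" "Cod C (g \<cdot> f) = Cod C g"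
  using Comp_in_hom[of f "Dom C f" "Cod C f" g "Cod C g"] assms by (auto simp: hom_def)

lemma Comp_Ide [simp]:
  assumes "f \<in> Arr C"
  shows "Dom C f = X \<Longrightarrow> f \<cdot> Ide C X = f" "Cod C f = X \<Longrightarrow> Ide C X \<cdot> f = f"
  using assms Comp_Ide_right[of f "Dom C f" "Cod C f"] Comp_Ide_left[of f "Dom C f" "Cod C f"]
  by (auto simp: hom_def)

lemma assoc:
  assumes "f \<in> Arr C" "g \<in> Arr C" "h \<in> Arr C" "Cod C f = Dom C g" "Cod C g = Dom C h"
  shows "(h \<cdot> g) \<cdot> f = h \<cdot> (g \<cdot> f)"
  using assms by (intro Comp_assoc[of f "Dom C f" "Cod C f" g "Cod C g" h "Cod C h"])
    (auto simp: hom_def)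

end

lemma categoryI:
  fixes C :: "('o, 'a) cat"
  assumes "\<And>f. f \<in> Arr C \<Longrightarrow> Dom C f \<in> Obj C \<and> Cod C f \<in> Obj C"
    and "\<And>X. X \<in> Obj C \<Longrightarrow> Ide C X \<in> Arr C \<and> Dom C (Ide C X) = X \<and> Cod C (Ide C X) = X"
    and "\<And>f g. \<lbrakk>f \<in> Arr C; g \<in> Arr C; Cod C f = Dom C g\<rbrakk> \<Longrightarrow>
      g \<cdot>\<^bsub>C\<^esub> f \<in> Arr C \<and> Dom C (g \<cdot>\<^bsub>C\<^esub> f) = Dom C f \<and> Cod C (g \<cdot>\<^bsub>C\<^esub> f) = Cod C g"
    and "\<And>f. f \<in> Arr C \<Longrightarrow> f \<cdot>\<^bsub>C\<^esub> Ide C (Dom C f) = f \<and> Ide C (Cod C f) \<cdot>\<^bsub>C\<^esub> f = f"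
    and "\<And>f g h. \<lbrakk>f \<in> Arr C; g \<in> Arr C; h \<in> Arr C; Cod C f = Dom C g; Cod C g = Dom C h\<rbrakk> \<Longrightarrow>
      (h \<cdot>\<^bsub>C\<^esub> g) \<cdot>\<^bsub>C\<^esub> f = h \<cdot>\<^bsub>C\<^esub> (g \<cdot>\<^bsub>C\<^esub> f)"
  shows "category C"
  by unfold_locales (use assms in \<open>auto simp: hom_def\<close>)

lemma category_prod_cat:
  assumes "category C" "category D"
  shows "category (prod_cat C D)"
proof -
  interpret C: category C by fact
  interpret D: category D by fact
  show ?thesis
    by (rule categoryI) (auto simp: prod_cat_def C.assoc D.assoc)
qed

locale cat_functor =
  fixes C :: "('o1, 'a1) cat" and D :: "('o2, 'a2) cat" and F :: "('o1, 'a1, 'o2, 'a2) func"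
  assumes is_functor: "is_functor C D F"
begin

sublocale source: category C
  using is_functor by (simp add: is_functor_def)

sublocale target: category D
  using is_functor by (simp add: is_functor_def)

lemma on_Obj [simp]: "X \<in> Obj C \<Longrightarrow> fobj F X \<in> Obj D"
  using is_functor by (auto simp: is_functor_def)

lemma on_Arr [simp]:
  assumes "f \<in> Arr C"
  shows "farr F f \<in> Arr D" "Dom D (farr F f) = fobj F (Dom C f)"
    "Cod D (farr F f) = fobj F (Cod C f)"
  using is_functor assms by (auto simp: is_functor_def hom_def)

lemma on_Ide [simp]: "X \<in> Obj C \<Longrightarrow> farr F (Ide C X) = Ide D (fobj F X)"
  using is_functor by (auto simp: is_functor_def)

lemma on_Comp:
  "\<lbrakk>f \<in> Arr C; g \<in> Arr C; Cod C f = Dom C g\<rbrakk> \<Longrightarrow>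
    farr F (g \<cdot>\<^bsub>C\<^esub> f) = farr F g \<cdot>\<^bsub>D\<^esub> farr F f"
  using is_functor by (auto simp: is_functor_def)

end

lemma is_functorI:
  assumes "category C" "category D"
    and "fobj F \<in> extensional (Obj C)" "farr F \<in> extensional (Arr C)"
    and "\<And>X. X \<in> Obj C \<Longrightarrow> fobj F X \<in> Obj D \<and> farr F (Ide C X) = Ide D (fobj F X)"
    and "\<And>f. f \<in> Arr C \<Longrightarrow> farr F f \<in> Arr D \<and> Dom D (farr F f) = fobj F (Dom C f) \<and>
      Cod D (farr F f) = fobj F (Cod C f)"
    and "\<And>f g. \<lbrakk>f \<in> Arr C; g \<in> Arr C; Cod C f = Dom C g\<rbrakk> \<Longrightarrow>
      farr F (g \<cdot>\<^bsub>C\<^esub> f) = farr F g \<cdot>\<^bsub>D\<^esub> farr F f"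
  shows "is_functor C D F"
  using assms by (auto simp: is_functor_def hom_def PiE_def)

lemma comp_func_simps [simp]:
  "X \<in> Obj C \<Longrightarrow> fobj (comp_func C G F) X = fobj G (fobj F X)"
  "f \<in> Arr C \<Longrightarrow> farr (comp_func C G F) f = farr G (farr F f)"
  by (simp_all add: comp_func_def)

lemma id_func_simps [simp]:
  "X \<in> Obj C \<Longrightarrow> fobj (id_func C) X = X"
  "f \<in> Arr C \<Longrightarrow> farr (id_func C) f = f"
  by (simp_all add: id_func_def)

lemma is_functor_id_func: "category C \<Longrightarrow> is_functor C C (id_func C)"
  by (rule is_functorI) (auto simp: id_func_def category.Dom_in_Obj category.Cod_in_Obj
      category.Ide_simps category.Comp_simps)

lemma is_functor_comp_func:
  assumes "is_functor C D F" "is_functor D E G"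
  shows "is_functor C E (comp_func C G F)"
proof -
  interpret F: cat_functor C D F by unfold_locales fact
  interpret G: cat_functor D E G by unfold_locales fact
  show ?thesis
    by (rule is_functorI)
      (auto simp: F.source.category_axioms G.target.category_axioms F.on_Comp G.on_Comp,
       auto simp: comp_func_def)
qed

text \<open>An inverse on objects and on arrows is automatically functorial, so for an isomorphism of
  categories nothing beyond the two bijections has to be checked.\<close>

lemma is_iso_functor_iff_bij_betw:
  assumes "is_functor C D K"
  shows "is_iso_functor C D K \<longleftrightarrow>
    bij_betw (fobj K) (Obj C) (Obj D) \<and> bij_betw (farr K) (Arr C) (Arr D)"
proof -
  interpret K: cat_functor C D K by unfold_locales fact
  show ?thesis
  proof
    assume "is_iso_functor C D K"
    then obtain L where L: "is_functor D C L"
      and LK: "comp_func C L K = id_func C" and KL: "comp_func D K L = id_func D"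
      by (auto simp: is_iso_functor_def)
    interpret L: cat_functor D C L by unfold_locales fact
    have "fobj L (fobj K X) = X" if "X \<in> Obj C" for X
      using arg_cong[OF LK, of "\<lambda>F. fobj F X"] that by simp
    moreover have "farr L (farr K f) = f" if "f \<in> Arr C" for f
      using arg_cong[OF LK, of "\<lambda>F. farr F f"] that by simp
    moreover have "fobj K (fobj L X) = X" if "X \<in> Obj D" for X
      using arg_cong[OF KL, of "\<lambda>F. fobj F X"] that by simp
    moreover have "farr K (farr L f) = f" if "f \<in> Arr D" for f
      using arg_cong[OF KL, of "\<lambda>F. farr F f"] that by simp
    ultimately show "bij_betw (fobj K) (Obj C) (Obj D) \<and> bij_betw (farr K) (Arr C) (Arr D)"
      by (auto intro!: bij_betw_byWitness[where f' = "fobj L"]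
          bij_betw_byWitness[where f' = "farr L"])
  next
    assume "bij_betw (fobj K) (Obj C) (Obj D) \<and> bij_betw (farr K) (Arr C) (Arr D)"
    then have bij: "bij_betw (fobj K) (Obj C) (Obj D)" "bij_betw (farr K) (Arr C) (Arr D)"
      by auto
    define L where "L = \<lparr>fobj = (\<lambda>X \<in> Obj D. inv_into (Obj C) (fobj K) X),
      farr = (\<lambda>f \<in> Arr D. inv_into (Arr C) (farr K) f)\<rparr>"
    have LObj: "fobj L Y \<in> Obj C" "fobj K (fobj L Y) = Y" if "Y \<in> Obj D" for Y
      using that bij(1) by (auto simp: L_def bij_betw_def inv_into_into f_inv_into_f)
    have LArr: "farr L g \<in> Arr C" "farr K (farr L g) = g" if "g \<in> Arr D" for g
      using that bij(2) by (auto simp: L_def bij_betw_def inv_into_into f_inv_into_f)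
    have eqObj: "X = X'" if "fobj K X = fobj K X'" "X \<in> Obj C" "X' \<in> Obj C" for X X'
      using that bij(1) by (auto simp: bij_betw_def dest: inj_onD)
    have eqArr: "f = f'" if "farr K f = farr K f'" "f \<in> Arr C" "f' \<in> Arr C" for f f'
      using that bij(2) by (auto simp: bij_betw_def dest: inj_onD)
    \<comment> \<open>Each law for \<open>L\<close> is proved after applying the injective \<open>K\<close>.\<close>
    have LDom: "Dom C (farr L g) = fobj L (Dom D g)" if "g \<in> Arr D" for g
      by (rule eqObj) (use that LArr LObj K.on_Arr(2)[of "farr L g"] in auto)
    have LCod: "Cod C (farr L g) = fobj L (Cod D g)" if "g \<in> Arr D" for g
      by (rule eqObj) (use that LArr LObj K.on_Arr(3)[of "farr L g"] in auto)
    have "is_functor D C L"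
    proof (rule is_functorI)
      fix X assume "X \<in> Obj D"
      then show "fobj L X \<in> Obj C \<and> farr L (Ide D X) = Ide C (fobj L X)"
        by (auto intro!: eqArr simp: LObj LArr)
    next
      fix f g assume "f \<in> Arr D" "g \<in> Arr D" "Cod D f = Dom D g"
      then show "farr L (g \<cdot>\<^bsub>D\<^esub> f) = farr L g \<cdot>\<^bsub>C\<^esub> farr L f"
        by (intro eqArr) (auto simp: LObj LArr LDom LCod K.on_Comp)
    qed (auto simp: LArr LDom LCod K.source.category_axioms K.target.category_axioms,
        auto simp: L_def)
    moreover have "comp_func C L K = id_func C"
      by (auto simp: comp_func_def id_func_def fun_eq_iff restrict_def
          intro!: eqObj eqArr LObj LArr)
    moreover have "comp_func D K L = id_func D"
      by (auto simp: comp_func_def id_func_def fun_eq_iff restrict_def LObj LArr)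
    ultimately show "is_iso_functor C D K"
      using assms by (auto simp: is_iso_functor_def)
  qed
qed


section \<open>The comparison functor of an adjunction\<close>

lemma category_em_cat:
  assumes "is_functor C C (endo M)"
  shows "category (em_cat C M)"
proof -
  interpret T: cat_functor C C "endo M" by unfold_locales fact
  \<comment> \<open>Pasting the squares of two composable algebra morphisms.\<close>
  have closed: "(h \<cdot>\<^bsub>C\<^esub> g) \<cdot>\<^bsub>C\<^esub> \<xi> = \<zeta> \<cdot>\<^bsub>C\<^esub> farr (endo M) (h \<cdot>\<^bsub>C\<^esub> g)"
    if "g \<in> hom C X Y" "h \<in> hom C Y Z" "em_algebra C M X \<xi>" "em_algebra C M Y \<theta>"
      "em_algebra C M Z \<zeta>" "g \<cdot>\<^bsub>C\<^esub> \<xi> = \<theta> \<cdot>\<^bsub>C\<^esub> farr (endo M) g"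
      "h \<cdot>\<^bsub>C\<^esub> \<theta> = \<zeta> \<cdot>\<^bsub>C\<^esub> farr (endo M) h" for g h X Y Z \<xi> \<theta> \<zeta>
  proof -
    have "(h \<cdot>\<^bsub>C\<^esub> g) \<cdot>\<^bsub>C\<^esub> \<xi> = (h \<cdot>\<^bsub>C\<^esub> \<theta>) \<cdot>\<^bsub>C\<^esub> farr (endo M) g"
      using that(1-6) by (auto simp: em_algebra_def hom_def T.source.assoc)
    also have "\<dots> = \<zeta> \<cdot>\<^bsub>C\<^esub> farr (endo M) (h \<cdot>\<^bsub>C\<^esub> g)"
      unfolding that(7) using that(1-5)
      by (auto simp: em_algebra_def hom_def T.source.assoc T.on_Comp)
    finally show ?thesis .
  qed
  show ?thesis
  proof (rule categoryI, goal_cases)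
    case (3 f g)
    then show ?case
      by (auto simp: em_cat_def closed T.source.Comp_in_hom)
  qed (auto simp: em_cat_def em_algebra_def hom_def T.source.assoc)
qed

locale adjoint_functors =
  fixes C :: "('oc, 'ac) cat" and D :: "('od, 'ad) cat"
    and F :: "('od, 'ad, 'oc, 'ac) func" and U :: "('oc, 'ac, 'od, 'ad) func"
    and \<eta> :: "'od \<Rightarrow> 'ad" and \<epsilon> :: "'oc \<Rightarrow> 'ac"
  assumes adjunction: "adjunction C D F U \<eta> \<epsilon>"
begin

sublocale C: category C
  using adjunction by (simp add: adjunction_def is_functor_def)

sublocale D: category D
  using adjunction by (simp add: adjunction_def is_functor_def)

sublocale F: cat_functor D C F
  using adjunction by unfold_locales (simp add: adjunction_def)

sublocale U: cat_functor C D U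
  using adjunction by unfold_locales (simp add: adjunction_def)

lemma unit_simps [simp]:
  assumes "X \<in> Obj D"
  shows "\<eta> X \<in> Arr D" "Dom D (\<eta> X) = X" "Cod D (\<eta> X) = fobj U (fobj F X)"
  using adjunction assms by (auto simp: adjunction_def nat_trans_def hom_def)

lemma unit_natural:
  "g \<in> Arr D \<Longrightarrow> farr U (farr F g) \<cdot>\<^bsub>D\<^esub> \<eta> (Dom D g) = \<eta> (Cod D g) \<cdot>\<^bsub>D\<^esub> g"
  using adjunction by (auto simp: adjunction_def nat_trans_def)

lemma counit_simps [simp]:
  assumes "Y \<in> Obj C"
  shows "\<epsilon> Y \<in> Arr C" "Dom C (\<epsilon> Y) = fobj F (fobj U Y)" "Cod C (\<epsilon> Y) = Y"
  using adjunction assms by (auto simp: adjunction_def nat_trans_def hom_def)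

lemma counit_natural:
  "f \<in> Arr C \<Longrightarrow> f \<cdot>\<^bsub>C\<^esub> \<epsilon> (Dom C f) = \<epsilon> (Cod C f) \<cdot>\<^bsub>C\<^esub> farr F (farr U f)"
  using adjunction by (auto simp: adjunction_def nat_trans_def)

lemma U_counit_unit: "Y \<in> Obj C \<Longrightarrow> farr U (\<epsilon> Y) \<cdot>\<^bsub>D\<^esub> \<eta> (fobj U Y) = Ide D (fobj U Y)"
  using adjunction by (auto simp: adjunction_def)

lemma U_counit_natural:
  assumes "f \<in> Arr C"
  shows "farr U f \<cdot>\<^bsub>D\<^esub> farr U (\<epsilon> (Dom C f)) =
    farr U (\<epsilon> (Cod C f)) \<cdot>\<^bsub>D\<^esub> farr U (farr F (farr U f))"
proof -
  have "farr U (f \<cdot>\<^bsub>C\<^esub> \<epsilon> (Dom C f)) = farr U (\<epsilon> (Cod C f) \<cdot>\<^bsub>C\<^esub> farr F (farr U f))"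
    using assms by (simp add: counit_natural)
  then show ?thesis
    using assms by (simp add: U.on_Comp)
qed

abbreviation "UF_monad \<equiv> induced_monad D F U \<eta> \<epsilon>"

lemma em_algebra_UF_monad_iff:
  "em_algebra D UF_monad x \<xi> \<longleftrightarrow>
    x \<in> Obj D \<and> \<xi> \<in> Arr D \<and> Dom D \<xi> = fobj U (fobj F x) \<and> Cod D \<xi> = x \<and>
    \<xi> \<cdot>\<^bsub>D\<^esub> \<eta> x = Ide D x \<and>
    \<xi> \<cdot>\<^bsub>D\<^esub> farr U (farr F \<xi>) = \<xi> \<cdot>\<^bsub>D\<^esub> farr U (\<epsilon> (fobj F x))"
  by (auto simp: em_algebra_def induced_monad_def hom_def)

lemma em_algebra_U_counit:
  assumes "Y \<in> Obj C"
  shows "em_algebra D UF_monad (fobj U Y) (farr U (\<epsilon> Y))"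
  using assms U_counit_natural[of "\<epsilon> Y"] by (simp add: em_algebra_UF_monad_iff U_counit_unit)

lemma Arr_em_cat_UF_monad_iff:
  "((x, \<xi>), g, (y, \<theta>)) \<in> Arr (em_cat D UF_monad) \<longleftrightarrow>
    em_algebra D UF_monad x \<xi> \<and> em_algebra D UF_monad y \<theta> \<and>
    g \<in> Arr D \<and> Dom D g = x \<and> Cod D g = y \<and> g \<cdot>\<^bsub>D\<^esub> \<xi> = \<theta> \<cdot>\<^bsub>D\<^esub> farr U (farr F g)"
  by (auto simp: em_cat_def induced_monad_def hom_def)

text \<open>The comparison is a functor because the triangle identity and the naturality of the
  counit make each \<open>U \<epsilon>\<^sub>Y\<close> an algebra and each \<open>U f\<close> an algebra morphism.\<close>

lemma is_functor_comparison: "is_functor C (em_cat D UF_monad) (comparison C U \<epsilon>)"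
proof (rule is_functorI)
  show "category (em_cat D UF_monad)"
    using is_functor_comp_func[OF F.is_functor U.is_functor]
    by (intro category_em_cat) (simp add: induced_monad_def)
next
  fix f assume f: "f \<in> Arr C"
  then have "farr (comparison C U \<epsilon>) f \<in> Arr (em_cat D UF_monad)"
    using U_counit_natural[OF f]
    by (simp add: comparison_def Arr_em_cat_UF_monad_iff em_algebra_U_counit)
  then show "farr (comparison C U \<epsilon>) f \<in> Arr (em_cat D UF_monad) \<and>
      Dom (em_cat D UF_monad) (farr (comparison C U \<epsilon>) f) = fobj (comparison C U \<epsilon>) (Dom C f) \<and>
      Cod (em_cat D UF_monad) (farr (comparison C U \<epsilon>) f) = fobj (comparison C U \<epsilon>) (Cod C f)"
    using f by (simp add: em_cat_def comparison_def)
qed (auto simp: comparison_def em_cat_def em_algebra_U_counit U.on_Comp C.category_axioms)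

end


section \<open>Monadic functors create limits\<close>

lemma limit_factor:
  assumes "is_limit J D G x \<tau>" "is_cone J D G y \<sigma>"
  obtains h where "h \<in> hom D y x" "\<And>j. j \<in> Obj J \<Longrightarrow> \<tau> j \<cdot>\<^bsub>D\<^esub> h = \<sigma> j"
proof -
  have "\<exists>!h. h \<in> hom D y x \<and> (\<forall>j \<in> Obj J. \<tau> j \<cdot>\<^bsub>D\<^esub> h = \<sigma> j)"
    using assms unfolding is_limit_def by simp
  then show ?thesis
    using that by blast
qed

text \<open>Composing a limit cone with an arrow gives a cone, and the uniqueness of factorizations
  applies to it.  In this form the universal property serves to prove equations.\<close>

lemma limit_jointly_monic:
  assumes "is_functor J D G" and lim: "is_limit J D G x \<tau>"
    and h: "h \<in> hom D y x" "h' \<in> hom D y x"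
    and eq: "\<And>j. j \<in> Obj J \<Longrightarrow> \<tau> j \<cdot>\<^bsub>D\<^esub> h = \<tau> j \<cdot>\<^bsub>D\<^esub> h'"
  shows "h = h'"
proof -
  interpret G: cat_functor J D G by unfold_locales fact
  have cone: "is_cone J D G x \<tau>"
    using lim by (simp add: is_limit_def)
  have "farr G u \<cdot>\<^bsub>D\<^esub> (\<tau> (Dom J u) \<cdot>\<^bsub>D\<^esub> h) = \<tau> (Cod J u) \<cdot>\<^bsub>D\<^esub> h" if "u \<in> Arr J" for u
  proof -
    have "farr G u \<cdot>\<^bsub>D\<^esub> (\<tau> (Dom J u) \<cdot>\<^bsub>D\<^esub> h) = (farr G u \<cdot>\<^bsub>D\<^esub> \<tau> (Dom J u)) \<cdot>\<^bsub>D\<^esub> h"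
      using cone that h by (subst G.target.assoc) (auto simp: is_cone_def hom_def)
    then show ?thesis
      using cone that by (simp add: is_cone_def)
  qed
  then have "is_cone J D G y (\<lambda>j \<in> Obj J. \<tau> j \<cdot>\<^bsub>D\<^esub> h)"
    using cone h G.target.Dom_in_Obj[of h] by (auto simp: is_cone_def hom_def)
  then have "\<exists>!k. k \<in> hom D y x \<and> (\<forall>j \<in> Obj J. \<tau> j \<cdot>\<^bsub>D\<^esub> k = (\<lambda>j \<in> Obj J. \<tau> j \<cdot>\<^bsub>D\<^esub> h) j)"
    using lim unfolding is_limit_def by blast
  then show ?thesis
    using h eq by (metis (no_types, lifting) restrict_apply')
qed

locale monadic_adjunction = adjoint_functors +
  assumes iso_comparison: "is_iso_functor C (em_cat D UF_monad) (comparison C U \<epsilon>)"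
begin

lemma bij_comparison:
  "bij_betw (fobj (comparison C U \<epsilon>)) (Obj C) (Obj (em_cat D UF_monad))"
  "bij_betw (farr (comparison C U \<epsilon>)) (Arr C) (Arr (em_cat D UF_monad))"
  using iso_comparison is_iso_functor_iff_bij_betw[OF is_functor_comparison] by auto

text \<open>All that creation of limits uses about the comparison isomorphism is contained in the
  following four lemmas: objects of \<open>C\<close> are the algebras of the induced monad, and arrows of \<open>C\<close>
  are the algebra morphisms.\<close>

lemma object_determined:
  assumes "c \<in> Obj C" "d \<in> Obj C" "fobj U c = fobj U d" "farr U (\<epsilon> c) = farr U (\<epsilon> d)"
  shows "c = d"
  using inj_onD[OF bij_betw_imp_inj_on[OF bij_comparison(1)], of c d] assms
  by (simp add: comparison_def)

lemma faithful:
  assumes "f \<in> Arr C" "f' \<in> Arr C" "Dom C f = Dom C f'" "Cod C f = Cod C f'"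
    "farr U f = farr U f'"
  shows "f = f'"
  using inj_onD[OF bij_betw_imp_inj_on[OF bij_comparison(2)], of f f'] assms
  by (simp add: comparison_def)

lemma algebra_lift:
  assumes "em_algebra D UF_monad x \<xi>"
  obtains c where "c \<in> Obj C" "fobj U c = x" "farr U (\<epsilon> c) = \<xi>"
proof -
  have "(x, \<xi>) \<in> fobj (comparison C U \<epsilon>) ` Obj C"
    using assms bij_betw_imp_surj_on[OF bij_comparison(1)] by (simp add: em_cat_def)
  then show ?thesis
    using that by (auto simp: comparison_def)
qed

lemma algebra_morphism_lift:
  assumes "c \<in> Obj C" "d \<in> Obj C"
    and "g \<in> Arr D" "Dom D g = fobj U c" "Cod D g = fobj U d"
    and "g \<cdot>\<^bsub>D\<^esub> farr U (\<epsilon> c) = farr U (\<epsilon> d) \<cdot>\<^bsub>D\<^esub> farr U (farr F g)"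
  obtains f where "f \<in> Arr C" "Dom C f = c" "Cod C f = d" "farr U f = g"
proof -
  have "((fobj U c, farr U (\<epsilon> c)), g, (fobj U d, farr U (\<epsilon> d))) \<in> Arr (em_cat D UF_monad)"
    using assms by (simp add: Arr_em_cat_UF_monad_iff em_algebra_U_counit)
  then have "((fobj U c, farr U (\<epsilon> c)), g, (fobj U d, farr U (\<epsilon> d)))
      \<in> farr (comparison C U \<epsilon>) ` Arr C"
    using bij_betw_imp_surj_on[OF bij_comparison(2)] by simp
  then obtain f where f: "f \<in> Arr C" "farr U f = g"
    and "fobj U c = fobj U (Dom C f)" "farr U (\<epsilon> c) = farr U (\<epsilon> (Dom C f))"
    and "fobj U d = fobj U (Cod C f)" "farr U (\<epsilon> d) = farr U (\<epsilon> (Cod C f))"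
    by (auto simp: comparison_def)
  then have "Dom C f = c" "Cod C f = d"
    using assms by (auto intro: object_determined)
  then show ?thesis
    using f that by blast
qed

lemma U_cone:
  assumes "is_functor J C G" "is_cone J C G c \<sigma>"
  shows "is_cone J D (comp_func J U G) (fobj U c) (\<lambda>j \<in> Obj J. farr U (\<sigma> j))"
proof -
  interpret G: cat_functor J C G by unfold_locales fact
  have "farr U (farr G u) \<cdot>\<^bsub>D\<^esub> farr U (\<sigma> (Dom J u)) = farr U (\<sigma> (Cod J u))" if "u \<in> Arr J" for u
  proof -
    have "farr U (farr G u) \<cdot>\<^bsub>D\<^esub> farr U (\<sigma> (Dom J u)) = farr U (farr G u \<cdot>\<^bsub>C\<^esub> \<sigma> (Dom J u))"
      using assms(2) that by (subst U.on_Comp) (auto simp: is_cone_def hom_def)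
    then show ?thesis
      using assms(2) that by (simp add: is_cone_def)
  qed
  then show ?thesis
    using assms(2) by (auto simp: is_cone_def hom_def)
qed

text \<open>Throughout this context \<open>(x, \<tau>)\<close> is a limit of \<open>U \<circ> G\<close>.\<close>

context
  fixes J :: "('j, 'k) cat" and G x \<tau>
  assumes G: "is_functor J C G" and lim: "is_limit J D (comp_func J U G) x \<tau>"
begin

interpretation G: cat_functor J C G
  by unfold_locales (rule G)

lemma limit_vertex [simp]: "x \<in> Obj D"
  using lim by (simp add: is_limit_def is_cone_def)

lemma limit_leg [simp]:
  assumes "j \<in> Obj J"
  shows "\<tau> j \<in> Arr D" "Dom D (\<tau> j) = x" "Cod D (\<tau> j) = fobj U (fobj G j)"
  using lim assms by (auto simp: is_limit_def is_cone_def hom_def)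

lemma limit_natural:
  "u \<in> Arr J \<Longrightarrow> farr U (farr G u) \<cdot>\<^bsub>D\<^esub> \<tau> (Dom J u) = \<tau> (Cod J u)"
  using lim by (auto simp: is_limit_def is_cone_def)

lemma eq_into_limit:
  assumes "h \<in> Arr D" "h' \<in> Arr D" "Dom D h = Dom D h'" "Cod D h = x" "Cod D h' = x"
    and "\<And>j. j \<in> Obj J \<Longrightarrow> \<tau> j \<cdot>\<^bsub>D\<^esub> h = \<tau> j \<cdot>\<^bsub>D\<^esub> h'"
  shows "h = h'"
  using limit_jointly_monic[OF is_functor_comp_func[OF G U.is_functor] lim, of h "Dom D h" h'] assms
  by (simp add: hom_def)

text \<open>The arrows \<open>U \<epsilon> \<cdot> U F (\<tau> j)\<close> form a cone with vertex \<open>U F x\<close>, so they factor through an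
  arrow \<open>\<xi> : U F x \<rightarrow> x\<close>, the only one that makes every \<open>\<tau> j\<close> a morphism of algebras.  Since the
  \<open>\<tau> j\<close> are jointly monic, \<open>\<xi>\<close> inherits the algebra laws from the algebras given by the
  objects \<open>G j\<close>.\<close>

lemma limit_structure:
  obtains \<xi> where "em_algebra D UF_monad x \<xi>"
    "\<And>j. j \<in> Obj J \<Longrightarrow>
      \<tau> j \<cdot>\<^bsub>D\<^esub> \<xi> = farr U (\<epsilon> (fobj G j)) \<cdot>\<^bsub>D\<^esub> farr U (farr F (\<tau> j))"
proof -
  let ?\<sigma> = "\<lambda>j. farr U (\<epsilon> (fobj G j)) \<cdot>\<^bsub>D\<^esub> farr U (farr F (\<tau> j))"
  have "farr U (farr G u) \<cdot>\<^bsub>D\<^esub> ?\<sigma> (Dom J u) = ?\<sigma> (Cod J u)" if u: "u \<in> Arr J" for u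
  proof -
    have "farr U (farr G u) \<cdot>\<^bsub>D\<^esub> ?\<sigma> (Dom J u) =
        (farr U (farr G u) \<cdot>\<^bsub>D\<^esub> farr U (\<epsilon> (fobj G (Dom J u)))) \<cdot>\<^bsub>D\<^esub> farr U (farr F (\<tau> (Dom J u)))"
      using u by (simp add: D.assoc)
    also have "\<dots> = farr U (\<epsilon> (fobj G (Cod J u))) \<cdot>\<^bsub>D\<^esub>
        (farr U (farr F (farr U (farr G u))) \<cdot>\<^bsub>D\<^esub> farr U (farr F (\<tau> (Dom J u))))"
      using u U_counit_natural[of "farr G u"] by (simp add: D.assoc)
    also have "farr U (farr F (farr U (farr G u))) \<cdot>\<^bsub>D\<^esub> farr U (farr F (\<tau> (Dom J u))) =
        farr U (farr F (farr U (farr G u) \<cdot>\<^bsub>D\<^esub> \<tau> (Dom J u)))"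
      using u by (simp add: U.on_Comp F.on_Comp)
    finally show ?thesis
      using u by (simp add: limit_natural)
  qed
  then have "is_cone J D (comp_func J U G) (fobj U (fobj F x)) (\<lambda>j \<in> Obj J. ?\<sigma> j)"
    by (auto simp: is_cone_def hom_def)
  then obtain \<xi> where "\<xi> \<in> hom D (fobj U (fobj F x)) x"
    and "\<And>j. j \<in> Obj J \<Longrightarrow> \<tau> j \<cdot>\<^bsub>D\<^esub> \<xi> = (\<lambda>j \<in> Obj J. ?\<sigma> j) j"
    by (rule limit_factor[OF lim]) auto
  then have \<xi>: "\<xi> \<in> Arr D" "Dom D \<xi> = fobj U (fobj F x)" "Cod D \<xi> = x"
    and leg: "\<And>j. j \<in> Obj J \<Longrightarrow> \<tau> j \<cdot>\<^bsub>D\<^esub> \<xi> = ?\<sigma> j"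
    by (auto simp: hom_def)
  \<comment> \<open>The two algebra laws are checked after composing with each leg of the limit.\<close>
  have "\<xi> \<cdot>\<^bsub>D\<^esub> \<eta> x = Ide D x"
  proof (rule eq_into_limit)
    fix j assume j: "j \<in> Obj J"
    have "\<tau> j \<cdot>\<^bsub>D\<^esub> (\<xi> \<cdot>\<^bsub>D\<^esub> \<eta> x) = (\<tau> j \<cdot>\<^bsub>D\<^esub> \<xi>) \<cdot>\<^bsub>D\<^esub> \<eta> x"
      using j \<xi> by (simp add: D.assoc)
    also have "\<dots> = farr U (\<epsilon> (fobj G j)) \<cdot>\<^bsub>D\<^esub> (farr U (farr F (\<tau> j)) \<cdot>\<^bsub>D\<^esub> \<eta> x)"
      using j by (simp add: leg D.assoc)
    also have "farr U (farr F (\<tau> j)) \<cdot>\<^bsub>D\<^esub> \<eta> x = \<eta> (fobj U (fobj G j)) \<cdot>\<^bsub>D\<^esub> \<tau> j"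
      using j unit_natural[of "\<tau> j"] by simp
    also have "farr U (\<epsilon> (fobj G j)) \<cdot>\<^bsub>D\<^esub> (\<eta> (fobj U (fobj G j)) \<cdot>\<^bsub>D\<^esub> \<tau> j) = \<tau> j"
      using j by (simp add: D.assoc[symmetric] U_counit_unit)
    finally show "\<tau> j \<cdot>\<^bsub>D\<^esub> (\<xi> \<cdot>\<^bsub>D\<^esub> \<eta> x) = \<tau> j \<cdot>\<^bsub>D\<^esub> Ide D x"
      using j by simp
  qed (use \<xi> in auto)
  moreover have "\<xi> \<cdot>\<^bsub>D\<^esub> farr U (farr F \<xi>) = \<xi> \<cdot>\<^bsub>D\<^esub> farr U (\<epsilon> (fobj F x))"
  proof (rule eq_into_limit)
    fix j assume j: "j \<in> Obj J"
    let ?e = "farr U (\<epsilon> (fobj G j))" and ?FF = "farr U (farr F (farr U (farr F (\<tau> j))))"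
    have "\<tau> j \<cdot>\<^bsub>D\<^esub> (\<xi> \<cdot>\<^bsub>D\<^esub> farr U (farr F \<xi>)) =
        (\<tau> j \<cdot>\<^bsub>D\<^esub> \<xi>) \<cdot>\<^bsub>D\<^esub> farr U (farr F \<xi>)"
      using j \<xi> by (simp add: D.assoc)
    also have "\<dots> = ?e \<cdot>\<^bsub>D\<^esub> (farr U (farr F (\<tau> j)) \<cdot>\<^bsub>D\<^esub> farr U (farr F \<xi>))"
      using j \<xi> by (simp add: leg D.assoc)
    also have "farr U (farr F (\<tau> j)) \<cdot>\<^bsub>D\<^esub> farr U (farr F \<xi>) = farr U (farr F (\<tau> j \<cdot>\<^bsub>D\<^esub> \<xi>))"
      using j \<xi> by (simp add: U.on_Comp F.on_Comp)
    also have "?e \<cdot>\<^bsub>D\<^esub> \<dots> = (?e \<cdot>\<^bsub>D\<^esub> farr U (farr F ?e)) \<cdot>\<^bsub>D\<^esub> ?FF"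
      using j by (simp add: leg U.on_Comp F.on_Comp D.assoc)
    also have "?e \<cdot>\<^bsub>D\<^esub> farr U (farr F ?e) = ?e \<cdot>\<^bsub>D\<^esub> farr U (\<epsilon> (fobj F (fobj U (fobj G j))))"
      using j U_counit_natural[of "\<epsilon> (fobj G j)"] by simp
    also have "(?e \<cdot>\<^bsub>D\<^esub> farr U (\<epsilon> (fobj F (fobj U (fobj G j))))) \<cdot>\<^bsub>D\<^esub> ?FF =
        ?e \<cdot>\<^bsub>D\<^esub> (farr U (farr F (\<tau> j)) \<cdot>\<^bsub>D\<^esub> farr U (\<epsilon> (fobj F x)))"
      using j U_counit_natural[of "farr F (\<tau> j)"] by (simp add: D.assoc)
    also have "\<dots> = \<tau> j \<cdot>\<^bsub>D\<^esub> (\<xi> \<cdot>\<^bsub>D\<^esub> farr U (\<epsilon> (fobj F x)))"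
      using j \<xi> by (simp add: D.assoc[symmetric] leg)
    finally show "\<tau> j \<cdot>\<^bsub>D\<^esub> (\<xi> \<cdot>\<^bsub>D\<^esub> farr U (farr F \<xi>)) =
      \<tau> j \<cdot>\<^bsub>D\<^esub> (\<xi> \<cdot>\<^bsub>D\<^esub> farr U (\<epsilon> (fobj F x)))" .
  qed (use \<xi> in auto)
  ultimately show ?thesis
    using \<xi> leg by (intro that) (simp_all add: em_algebra_UF_monad_iff)
qed

lemma lift_legs:
  assumes "lifts_cone J C U G x \<tau> c \<sigma>"
  shows "c \<in> Obj C" "fobj U c = x" "\<sigma> \<in> extensional (Obj J)"
    "\<And>j. j \<in> Obj J \<Longrightarrow> \<sigma> j \<in> Arr C \<and> Dom C (\<sigma> j) = c \<and> Cod C (\<sigma> j) = fobj G j \<and>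
      farr U (\<sigma> j) = \<tau> j"
  using assms by (auto simp: lifts_cone_def is_cone_def hom_def)

text \<open>By naturality of the counit, this equation holds for every lift.  As the \<open>\<tau> j\<close> are jointly
  monic, it determines the structure map \<open>U \<epsilon>\<^sub>c\<close>, and hence the vertex \<open>c\<close> of the lift.\<close>

lemma lift_structure:
  assumes "lifts_cone J C U G x \<tau> c \<sigma>" "j \<in> Obj J"
  shows "\<tau> j \<cdot>\<^bsub>D\<^esub> farr U (\<epsilon> c) = farr U (\<epsilon> (fobj G j)) \<cdot>\<^bsub>D\<^esub> farr U (farr F (\<tau> j))"
  using U_counit_natural[of "\<sigma> j"] lift_legs[OF assms(1)] assms(2) by simp

lemma ex_lift: "\<exists>c \<sigma>. lifts_cone J C U G x \<tau> c \<sigma>"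
proof -
  obtain \<xi> where alg: "em_algebra D UF_monad x \<xi>" and leg: "\<And>j. j \<in> Obj J \<Longrightarrow>
      \<tau> j \<cdot>\<^bsub>D\<^esub> \<xi> = farr U (\<epsilon> (fobj G j)) \<cdot>\<^bsub>D\<^esub> farr U (farr F (\<tau> j))"
    by (rule limit_structure) blast
  obtain c where c: "c \<in> Obj C" "fobj U c = x" "farr U (\<epsilon> c) = \<xi>"
    using alg by (rule algebra_lift)
  have "\<exists>f. f \<in> Arr C \<and> Dom C f = c \<and> Cod C f = fobj G j \<and> farr U f = \<tau> j" if "j \<in> Obj J" for j
    by (rule algebra_morphism_lift[of c "fobj G j" "\<tau> j"]) (use that c leg in auto)
  then obtain s where s: "\<And>j. j \<in> Obj J \<Longrightarrow> s j \<in> Arr C \<and> Dom C (s j) = c \<and>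
      Cod C (s j) = fobj G j \<and> farr U (s j) = \<tau> j"
    by metis
  have "farr G u \<cdot>\<^bsub>C\<^esub> s (Dom J u) = s (Cod J u)" if "u \<in> Arr J" for u
    by (rule faithful) (use that s in \<open>auto simp: U.on_Comp limit_natural\<close>)
  then have "lifts_cone J C U G x \<tau> c (\<lambda>j \<in> Obj J. s j)"
    using s c by (auto simp: lifts_cone_def is_cone_def hom_def)
  then show ?thesis
    by blast
qed

lemma lift_unique:
  assumes "lifts_cone J C U G x \<tau> c \<sigma>" "lifts_cone J C U G x \<tau> c' \<sigma>'"
  shows "c = c'" "\<sigma> = \<sigma>'"
proof -
  note l = lift_legs[OF assms(1)] and l' = lift_legs[OF assms(2)]
  have "farr U (\<epsilon> c) = farr U (\<epsilon> c')"
    by (rule eq_into_limit) (use l l' lift_structure[OF assms(1)] lift_structure[OF assms(2)] in auto)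
  then show c: "c = c'"
    using l l' by (intro object_determined) auto
  show "\<sigma> = \<sigma>'"
    by (rule extensionalityI[OF l(3) l'(3)], rule faithful) (use l(4) l'(4) c in auto)
qed

text \<open>The factorization \<open>h\<close> of the image of a cone in \<open>D\<close> is an algebra morphism, since this can
  be tested on the legs; so it lifts to \<open>C\<close>.\<close>

lemma lift_is_limit:
  assumes lift: "lifts_cone J C U G x \<tau> c \<sigma>"
  shows "is_limit J C G c \<sigma>"
  unfolding is_limit_def
proof (intro conjI allI impI)
  note l = lift_legs[OF lift]
  show "is_cone J C G c \<sigma>"
    using lift by (simp add: lifts_cone_def)
  fix c' \<sigma>' assume cone: "is_cone J C G c' \<sigma>'"
  then have c': "c' \<in> Obj C"
    and \<sigma>': "\<And>j. j \<in> Obj J \<Longrightarrow> \<sigma>' j \<in> Arr C \<and> Dom C (\<sigma>' j) = c' \<and> Cod C (\<sigma>' j) = fobj G j"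
    by (auto simp: is_cone_def hom_def)
  obtain h where "h \<in> hom D (fobj U c') x"
    and "\<And>j. j \<in> Obj J \<Longrightarrow> \<tau> j \<cdot>\<^bsub>D\<^esub> h = (\<lambda>j \<in> Obj J. farr U (\<sigma>' j)) j"
    using limit_factor[OF lim U_cone[OF G cone]] by blast
  then have h: "h \<in> Arr D" "Dom D h = fobj U c'" "Cod D h = x"
    and \<tau>h: "\<And>j. j \<in> Obj J \<Longrightarrow> \<tau> j \<cdot>\<^bsub>D\<^esub> h = farr U (\<sigma>' j)"
    by (auto simp: hom_def)
  have "h \<cdot>\<^bsub>D\<^esub> farr U (\<epsilon> c') = farr U (\<epsilon> c) \<cdot>\<^bsub>D\<^esub> farr U (farr F h)"
  proof (rule eq_into_limit)
    fix j assume j: "j \<in> Obj J"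
    have "\<tau> j \<cdot>\<^bsub>D\<^esub> (h \<cdot>\<^bsub>D\<^esub> farr U (\<epsilon> c')) = farr U (\<sigma>' j) \<cdot>\<^bsub>D\<^esub> farr U (\<epsilon> c')"
      using j h c' by (simp add: D.assoc[symmetric] \<tau>h)
    also have "\<dots> = farr U (\<epsilon> (fobj G j)) \<cdot>\<^bsub>D\<^esub> farr U (farr F (\<tau> j \<cdot>\<^bsub>D\<^esub> h))"
      using j U_counit_natural[of "\<sigma>' j"] \<sigma>' by (simp add: \<tau>h)
    also have "\<dots> = (\<tau> j \<cdot>\<^bsub>D\<^esub> farr U (\<epsilon> c)) \<cdot>\<^bsub>D\<^esub> farr U (farr F h)"
      using j h by (simp add: lift_structure[OF lift] D.assoc U.on_Comp F.on_Comp)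
    also have "\<dots> = \<tau> j \<cdot>\<^bsub>D\<^esub> (farr U (\<epsilon> c) \<cdot>\<^bsub>D\<^esub> farr U (farr F h))"
      using j h l by (simp add: D.assoc)
    finally show "\<tau> j \<cdot>\<^bsub>D\<^esub> (h \<cdot>\<^bsub>D\<^esub> farr U (\<epsilon> c')) =
      \<tau> j \<cdot>\<^bsub>D\<^esub> (farr U (\<epsilon> c) \<cdot>\<^bsub>D\<^esub> farr U (farr F h))" .
  qed (use h l c' in auto)
  then obtain k where k: "k \<in> Arr C" "Dom C k = c'" "Cod C k = c" "farr U k = h"
    using algebra_morphism_lift[of c' c h] h l c' by metis
  show "\<exists>!k. k \<in> hom C c' c \<and> (\<forall>j \<in> Obj J. \<sigma> j \<cdot>\<^bsub>C\<^esub> k = \<sigma>' j)"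
  proof (rule ex1I)
    have "\<sigma> j \<cdot>\<^bsub>C\<^esub> k = \<sigma>' j" if "j \<in> Obj J" for j
      by (rule faithful) (use that k l \<sigma>' \<tau>h in \<open>auto simp: U.on_Comp\<close>)
    then show "k \<in> hom C c' c \<and> (\<forall>j \<in> Obj J. \<sigma> j \<cdot>\<^bsub>C\<^esub> k = \<sigma>' j)"
      using k by (auto simp: hom_def)
  next
    fix k' assume "k' \<in> hom C c' c \<and> (\<forall>j \<in> Obj J. \<sigma> j \<cdot>\<^bsub>C\<^esub> k' = \<sigma>' j)"
    then have k': "k' \<in> Arr C" "Dom C k' = c'" "Cod C k' = c"
      and \<sigma>k': "\<And>j. j \<in> Obj J \<Longrightarrow> \<sigma> j \<cdot>\<^bsub>C\<^esub> k' = \<sigma>' j"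
      by (auto simp: hom_def)
    have "farr U k' = h"
    proof (rule eq_into_limit)
      fix j assume j: "j \<in> Obj J"
      then show "\<tau> j \<cdot>\<^bsub>D\<^esub> farr U k' = \<tau> j \<cdot>\<^bsub>D\<^esub> h"
        using U.on_Comp[of k' "\<sigma> j"] k' l(4)[OF j] by (simp add: \<sigma>k' \<tau>h)
    qed (use h k' l in auto)
    then show "k' = k"
      using k k' by (intro faithful) auto
  qed
qed

end

end

lemma monadic_creates_limits:
  assumes "monadic C D U"
  shows "creates_limits_of_shape J C D U"
proof -
  obtain F \<eta> \<epsilon> where "adjunction C D F U \<eta> \<epsilon>"
    "is_iso_functor C (em_cat D (induced_monad D F U \<eta> \<epsilon>)) (comparison C U \<epsilon>)"
    using assms by (auto simp: monadic_def)
  then interpret monadic_adjunction C D F U \<eta> \<epsilon>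
    by unfold_locales
  show ?thesis
    unfolding creates_limits_of_shape_def
  proof (intro allI impI)
    fix G x \<tau>
    assume G: "is_functor J C G" and lim: "is_limit J D (comp_func J U G) x \<tau>"
    obtain c \<sigma> where "lifts_cone J C U G x \<tau> c \<sigma>"
      using ex_lift[OF G lim] by blast
    then have "\<exists>!(c, \<sigma>). lifts_cone J C U G x \<tau> c \<sigma>"
      by (intro ex1I[of _ "(c, \<sigma>)"]) (auto dest: lift_unique[OF G lim])
    then show "(\<exists>!(c, \<sigma>). lifts_cone J C U G x \<tau> c \<sigma>) \<and>
        (\<forall>c \<sigma>. lifts_cone J C U G x \<tau> c \<sigma> \<longrightarrow> is_limit J C G c \<sigma>)"
      using lift_is_limit[OF G lim] by blast
  qed
qed


section \<open>The two-variable functor of a parametrized monad\<close>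

locale param_monad =
  fixes \<A> :: "('ao, 'aa) cat" and \<X> :: "('xo, 'xa) cat" and T :: "('ao, 'aa, 'xo, 'xa) pmonad"
  assumes parametrized_monad: "parametrized_monad \<A> \<X> T"
begin

sublocale A: category \<A>
  using parametrized_monad by (simp add: parametrized_monad_def)

sublocale X: category \<X>
  using parametrized_monad by (simp add: parametrized_monad_def)

sublocale T: cat_functor \<A> "Mnd \<X>" T
  using parametrized_monad by unfold_locales (simp add: parametrized_monad_def)

abbreviation "T_obj A X \<equiv> fobj (endo (fobj T A)) X"
abbreviation "T_arr A g \<equiv> farr (endo (fobj T A)) g"
abbreviation "unit A X \<equiv> eta (fobj T A) X"
abbreviation "mult A X \<equiv> mu (fobj T A) X"
abbreviation "T_trans f X \<equiv> pcomponent T f X"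
abbreviation "T_map f g \<equiv> pmap \<A> \<X> T f g"

lemma is_monad: "A \<in> Obj \<A> \<Longrightarrow> is_monad \<X> (fobj T A)"
  using T.on_Obj[of A] by (simp add: Mnd_def)

lemma cat_functor_monad: "A \<in> Obj \<A> \<Longrightarrow> cat_functor \<X> \<X> (endo (fobj T A))"
  using is_monad[of A] by unfold_locales (simp add: is_monad_def nat_trans_def)

lemma monad_functor_simps [simp]:
  assumes "A \<in> Obj \<A>"
  shows "X \<in> Obj \<X> \<Longrightarrow> T_obj A X \<in> Obj \<X>"
    "X \<in> Obj \<X> \<Longrightarrow> T_arr A (Ide \<X> X) = Ide \<X> (T_obj A X)"
    "g \<in> Arr \<X> \<Longrightarrow> T_arr A g \<in> Arr \<X>"
    "g \<in> Arr \<X> \<Longrightarrow> Dom \<X> (T_arr A g) = T_obj A (Dom \<X> g)"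
    "g \<in> Arr \<X> \<Longrightarrow> Cod \<X> (T_arr A g) = T_obj A (Cod \<X> g)"
proof -
  interpret TA: cat_functor \<X> \<X> "endo (fobj T A)"
    using assms by (rule cat_functor_monad)
  show "X \<in> Obj \<X> \<Longrightarrow> T_obj A X \<in> Obj \<X>"
    "X \<in> Obj \<X> \<Longrightarrow> T_arr A (Ide \<X> X) = Ide \<X> (T_obj A X)"
    "g \<in> Arr \<X> \<Longrightarrow> T_arr A g \<in> Arr \<X>"
    "g \<in> Arr \<X> \<Longrightarrow> Dom \<X> (T_arr A g) = T_obj A (Dom \<X> g)"
    "g \<in> Arr \<X> \<Longrightarrow> Cod \<X> (T_arr A g) = T_obj A (Cod \<X> g)"
    by simp_all
qed

lemma T_arr_Comp:
  assumes "A \<in> Obj \<A>" "f \<in> Arr \<X>" "g \<in> Arr \<X>" "Cod \<X> f = Dom \<X> g"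
  shows "T_arr A (g \<cdot>\<^bsub>\<X>\<^esub> f) = T_arr A g \<cdot>\<^bsub>\<X>\<^esub> T_arr A f"
  using cat_functor.on_Comp[OF cat_functor_monad] assms .

lemma unit_simps [simp]:
  assumes "A \<in> Obj \<A>" "X \<in> Obj \<X>"
  shows "unit A X \<in> Arr \<X>" "Dom \<X> (unit A X) = X" "Cod \<X> (unit A X) = T_obj A X"
  using is_monad assms by (auto simp: is_monad_def nat_trans_def hom_def)

lemma mult_simps [simp]:
  assumes "A \<in> Obj \<A>" "X \<in> Obj \<X>"
  shows "mult A X \<in> Arr \<X>" "Dom \<X> (mult A X) = T_obj A (T_obj A X)" "Cod \<X> (mult A X) = T_obj A X"
  using is_monad assms by (auto simp: is_monad_def nat_trans_def hom_def)

lemma unit_natural: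
  "\<lbrakk>A \<in> Obj \<A>; g \<in> Arr \<X>\<rbrakk> \<Longrightarrow>
    T_arr A g \<cdot>\<^bsub>\<X>\<^esub> unit A (Dom \<X> g) = unit A (Cod \<X> g) \<cdot>\<^bsub>\<X>\<^esub> g"
  using is_monad[of A] by (auto simp: is_monad_def nat_trans_def)

lemma mult_natural:
  "\<lbrakk>A \<in> Obj \<A>; g \<in> Arr \<X>\<rbrakk> \<Longrightarrow>
    T_arr A g \<cdot>\<^bsub>\<X>\<^esub> mult A (Dom \<X> g) = mult A (Cod \<X> g) \<cdot>\<^bsub>\<X>\<^esub> T_arr A (T_arr A g)"
  using is_monad[of A] by (auto simp: is_monad_def nat_trans_def)

lemma monad_laws:
  assumes "A \<in> Obj \<A>" "X \<in> Obj \<X>"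
  shows "mult A X \<cdot>\<^bsub>\<X>\<^esub> T_arr A (unit A X) = Ide \<X> (T_obj A X)"
    "mult A X \<cdot>\<^bsub>\<X>\<^esub> unit A (T_obj A X) = Ide \<X> (T_obj A X)"
    "mult A X \<cdot>\<^bsub>\<X>\<^esub> T_arr A (mult A X) = mult A X \<cdot>\<^bsub>\<X>\<^esub> mult A (T_obj A X)"
  using is_monad assms by (auto simp: is_monad_def)

text \<open>An arrow of \<open>Mnd\<close> is a triple; its outer components are forced by functoriality, so \<open>T\<^sub>f\<close>
  amounts to the family \<open>T_trans f\<close>, and this family is a morphism of monads.\<close>

lemma farr_T:
  assumes "f \<in> Arr \<A>"
  shows "farr T f = (fobj T (Dom \<A> f), T_trans f, fobj T (Cod \<A> f))"
    "monad_morphism \<X> (fobj T (Dom \<A> f)) (fobj T (Cod \<A> f)) (T_trans f)"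
  using T.on_Arr[OF assms] by (auto simp: Mnd_def pcomponent_def split: prod.splits)

lemma T_trans_simps [simp]:
  assumes "f \<in> Arr \<A>" "X \<in> Obj \<X>"
  shows "T_trans f X \<in> Arr \<X>" "Dom \<X> (T_trans f X) = T_obj (Dom \<A> f) X"
    "Cod \<X> (T_trans f X) = T_obj (Cod \<A> f) X"
  using farr_T(2)[OF assms(1)] assms(2)
  by (auto simp: monad_morphism_def nat_trans_def hom_def)

lemma T_trans_natural:
  "\<lbrakk>f \<in> Arr \<A>; g \<in> Arr \<X>\<rbrakk> \<Longrightarrow>
    T_arr (Cod \<A> f) g \<cdot>\<^bsub>\<X>\<^esub> T_trans f (Dom \<X> g) = T_trans f (Cod \<X> g) \<cdot>\<^bsub>\<X>\<^esub> T_arr (Dom \<A> f) g"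
  using farr_T(2)[of f] by (auto simp: monad_morphism_def nat_trans_def)

lemma T_trans_unit:
  "\<lbrakk>f \<in> Arr \<A>; X \<in> Obj \<X>\<rbrakk> \<Longrightarrow> T_trans f X \<cdot>\<^bsub>\<X>\<^esub> unit (Dom \<A> f) X = unit (Cod \<A> f) X"
  using farr_T(2)[of f] by (auto simp: monad_morphism_def)

lemma T_trans_mult:
  "\<lbrakk>f \<in> Arr \<A>; X \<in> Obj \<X>\<rbrakk> \<Longrightarrow> T_trans f X \<cdot>\<^bsub>\<X>\<^esub> mult (Dom \<A> f) X =
    mult (Cod \<A> f) X \<cdot>\<^bsub>\<X>\<^esub> (T_arr (Cod \<A> f) (T_trans f X) \<cdot>\<^bsub>\<X>\<^esub> T_trans f (T_obj (Dom \<A> f) X))"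
  using farr_T(2)[of f] by (auto simp: monad_morphism_def)

lemma T_trans_Ide: "\<lbrakk>A \<in> Obj \<A>; X \<in> Obj \<X>\<rbrakk> \<Longrightarrow> T_trans (Ide \<A> A) X = Ide \<X> (T_obj A X)"
  using T.on_Ide[of A] by (simp add: Mnd_def pcomponent_def)

lemma T_trans_Comp:
  assumes "f \<in> Arr \<A>" "f' \<in> Arr \<A>" "Cod \<A> f = Dom \<A> f'" "X \<in> Obj \<X>"
  shows "T_trans (f' \<cdot>\<^bsub>\<A>\<^esub> f) X = T_trans f' X \<cdot>\<^bsub>\<X>\<^esub> T_trans f X"
proof -
  have "farr T (f' \<cdot>\<^bsub>\<A>\<^esub> f) = farr T f' \<cdot>\<^bsub>Mnd \<X>\<^esub> farr T f"
    using assms by (intro T.on_Comp)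
  also have "\<dots> = (fobj T (Dom \<A> f), \<lambda>X \<in> Obj \<X>. T_trans f' X \<cdot>\<^bsub>\<X>\<^esub> T_trans f X, fobj T (Cod \<A> f'))"
    using assms by (simp add: farr_T(1) Mnd_def)
  finally have "pcomponent T (f' \<cdot>\<^bsub>\<A>\<^esub> f) = (\<lambda>X \<in> Obj \<X>. T_trans f' X \<cdot>\<^bsub>\<X>\<^esub> T_trans f X)"
    by (simp add: pcomponent_def[abs_def])
  then show ?thesis
    using assms by simp
qed

lemma T_map_simps [simp]:
  assumes "f \<in> Arr \<A>" "g \<in> Arr \<X>"
  shows "T_map f g \<in> Arr \<X>" "Dom \<X> (T_map f g) = T_obj (Dom \<A> f) (Dom \<X> g)"
    "Cod \<X> (T_map f g) = T_obj (Cod \<A> f) (Cod \<X> g)"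
  using assms by (simp_all add: pmap_def)

lemma T_map_Ide [simp]:
  assumes "A \<in> Obj \<A>" "g \<in> Arr \<X>"
  shows "T_map (Ide \<A> A) g = T_arr A g"
  using assms by (simp add: pmap_def T_trans_Ide)

text \<open>Functoriality of \<open>(f, g) \<mapsto> T(f, g)\<close>: the interchange of \<open>T_trans f\<close> with \<open>T_arr g\<close> is the
  naturality of the monad morphism \<open>T\<^sub>f\<close>.\<close>

lemma T_map_Comp:
  assumes "f \<in> Arr \<A>" "f' \<in> Arr \<A>" "Cod \<A> f = Dom \<A> f'"
    and "g \<in> Arr \<X>" "g' \<in> Arr \<X>" "Cod \<X> g = Dom \<X> g'"
  shows "T_map (f' \<cdot>\<^bsub>\<A>\<^esub> f) (g' \<cdot>\<^bsub>\<X>\<^esub> g) = T_map f' g' \<cdot>\<^bsub>\<X>\<^esub> T_map f g"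
proof -
  let ?Z = "Cod \<X> g'"
  have "T_map (f' \<cdot>\<^bsub>\<A>\<^esub> f) (g' \<cdot>\<^bsub>\<X>\<^esub> g) =
      T_trans f' ?Z \<cdot>\<^bsub>\<X>\<^esub> ((T_trans f ?Z \<cdot>\<^bsub>\<X>\<^esub> T_arr (Dom \<A> f) g') \<cdot>\<^bsub>\<X>\<^esub> T_arr (Dom \<A> f) g)"
    using assms by (simp add: pmap_def T_trans_Comp T_arr_Comp X.assoc)
  also have "T_trans f ?Z \<cdot>\<^bsub>\<X>\<^esub> T_arr (Dom \<A> f) g' = T_arr (Dom \<A> f') g' \<cdot>\<^bsub>\<X>\<^esub> T_trans f (Cod \<X> g)"
    using T_trans_natural[of f g'] assms by simp
  finally show ?thesis
    using assms by (simp add: pmap_def X.assoc)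
qed

text \<open>This equation and the next one say that the units and the multiplications are natural in
  both variables, \<open>(A, X)\<close> ranging over \<open>\<A> \<times> \<X>\<close>.  It is here that \<open>T\<^sub>f\<close> has to be
  compatible with the monad structures and not only a natural transformation.\<close>

lemma T_map_unit:
  assumes "f \<in> Arr \<A>" "g \<in> Arr \<X>"
  shows "T_map f g \<cdot>\<^bsub>\<X>\<^esub> unit (Dom \<A> f) (Dom \<X> g) = unit (Cod \<A> f) (Cod \<X> g) \<cdot>\<^bsub>\<X>\<^esub> g"
proof -
  have "T_map f g \<cdot>\<^bsub>\<X>\<^esub> unit (Dom \<A> f) (Dom \<X> g) =
      (T_trans f (Cod \<X> g) \<cdot>\<^bsub>\<X>\<^esub> unit (Dom \<A> f) (Cod \<X> g)) \<cdot>\<^bsub>\<X>\<^esub> g"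
    using assms by (simp add: pmap_def X.assoc unit_natural)
  then show ?thesis
    using assms by (simp add: T_trans_unit)
qed

lemma T_map_mult:
  assumes "f \<in> Arr \<A>" "g \<in> Arr \<X>"
  shows "T_map f g \<cdot>\<^bsub>\<X>\<^esub> mult (Dom \<A> f) (Dom \<X> g) = mult (Cod \<A> f) (Cod \<X> g) \<cdot>\<^bsub>\<X>\<^esub> T_map f (T_map f g)"
proof -
  let ?A = "Dom \<A> f" and ?B = "Cod \<A> f" and ?Y = "Cod \<X> g"
  have "T_map f g \<cdot>\<^bsub>\<X>\<^esub> mult ?A (Dom \<X> g) =
      (T_trans f ?Y \<cdot>\<^bsub>\<X>\<^esub> mult ?A ?Y) \<cdot>\<^bsub>\<X>\<^esub> T_arr ?A (T_arr ?A g)"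
    using assms by (simp add: pmap_def X.assoc mult_natural)
  also have "\<dots> = mult ?B ?Y \<cdot>\<^bsub>\<X>\<^esub>
      ((T_arr ?B (T_trans f ?Y) \<cdot>\<^bsub>\<X>\<^esub> T_trans f (T_obj ?A ?Y)) \<cdot>\<^bsub>\<X>\<^esub> T_arr ?A (T_arr ?A g))"
    using assms by (simp add: T_trans_mult X.assoc)
  also have "T_arr ?B (T_trans f ?Y) \<cdot>\<^bsub>\<X>\<^esub> T_trans f (T_obj ?A ?Y) =
      T_trans f (T_obj ?B ?Y) \<cdot>\<^bsub>\<X>\<^esub> T_arr ?A (T_trans f ?Y)"
    using T_trans_natural[of f "T_trans f ?Y"] assms by simp
  finally show ?thesis
    using assms by (simp add: pmap_def T_arr_Comp X.assoc)
qed


section \<open>The category of algebras over all parameters\<close>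

abbreviation "S \<equiv> semidirect \<A> \<X> T"
abbreviation "P \<equiv> prod_cat \<A> \<X>"

text \<open>An object of \<open>\<A> \<ltimes> \<X>\<close>, with the typing of \<open>\<xi>\<close> expressed by \<open>Dom\<close> and \<open>Cod\<close>.\<close>

definition algebra :: "'ao \<times> 'xo \<times> 'xa \<Rightarrow> bool" where
  "algebra = (\<lambda>(A, X, \<xi>). A \<in> Obj \<A> \<and> X \<in> Obj \<X> \<and>
     \<xi> \<in> Arr \<X> \<and> Dom \<X> \<xi> = T_obj A X \<and> Cod \<X> \<xi> = X \<and>
     \<xi> \<cdot>\<^bsub>\<X>\<^esub> unit A X = Ide \<X> X \<and> \<xi> \<cdot>\<^bsub>\<X>\<^esub> T_arr A \<xi> = \<xi> \<cdot>\<^bsub>\<X>\<^esub> mult A X)"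

lemma algebra_simps:
  assumes "algebra (A, X, \<xi>)"
  shows "A \<in> Obj \<A>" "X \<in> Obj \<X>" "\<xi> \<in> Arr \<X>" "Dom \<X> \<xi> = T_obj A X" "Cod \<X> \<xi> = X"
  using assms by (auto simp: algebra_def)

lemma semidirect_simps [simp]:
  "s \<in> Obj S \<longleftrightarrow> algebra s"
  "Dom S (s, fg, t) = s" "Cod S (s, fg, t) = t"
  "Ide S (A, X, \<xi>) = ((A, X, \<xi>), (Ide \<A> A, Ide \<X> X), (A, X, \<xi>))"
  "(s', (f', g'), t') \<cdot>\<^bsub>S\<^esub> (s, (f, g), t) = (s, (f' \<cdot>\<^bsub>\<A>\<^esub> f, g' \<cdot>\<^bsub>\<X>\<^esub> g), t')"
  by (auto simp: semidirect_def algebra_def em_algebra_def hom_def)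

lemma Arr_semidirect_iff:
  "((A, X, \<xi>), (f, g), (B, Y, \<theta>)) \<in> Arr S \<longleftrightarrow> algebra (A, X, \<xi>) \<and> algebra (B, Y, \<theta>) \<and>
    f \<in> Arr \<A> \<and> Dom \<A> f = A \<and> Cod \<A> f = B \<and> g \<in> Arr \<X> \<and> Dom \<X> g = X \<and> Cod \<X> g = Y \<and>
    g \<cdot>\<^bsub>\<X>\<^esub> \<xi> = \<theta> \<cdot>\<^bsub>\<X>\<^esub> T_map f g"
  by (auto simp: semidirect_def algebra_def em_algebra_def hom_def)

lemma prod_cat_simps [simp]:
  "Obj P = Obj \<A> \<times> Obj \<X>" "Arr P = Arr \<A> \<times> Arr \<X>"
  "Dom P (f, g) = (Dom \<A> f, Dom \<X> g)" "Cod P (f, g) = (Cod \<A> f, Cod \<X> g)"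
  "Ide P (A, X) = (Ide \<A> A, Ide \<X> X)"
  "(f', g') \<cdot>\<^bsub>P\<^esub> (f, g) = (f' \<cdot>\<^bsub>\<A>\<^esub> f, g' \<cdot>\<^bsub>\<X>\<^esub> g)"
  by (auto simp: prod_cat_def)

lemma category_P: "category P"
  by (rule category_prod_cat) unfold_locales

lemma morphism_square_Comp:
  assumes "((A, X, \<xi>), (f, g), (B, Y, \<theta>)) \<in> Arr S" "((B, Y, \<theta>), (f', g'), (C, Z, \<zeta>)) \<in> Arr S"
  shows "((A, X, \<xi>), (f' \<cdot>\<^bsub>\<A>\<^esub> f, g' \<cdot>\<^bsub>\<X>\<^esub> g), (C, Z, \<zeta>)) \<in> Arr S"
proof -
  have alg: "algebra (A, X, \<xi>)" "algebra (B, Y, \<theta>)" "algebra (C, Z, \<zeta>)"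
    and f: "f \<in> Arr \<A>" "Dom \<A> f = A" "Cod \<A> f = B" "f' \<in> Arr \<A>" "Dom \<A> f' = B" "Cod \<A> f' = C"
    and g: "g \<in> Arr \<X>" "Dom \<X> g = X" "Cod \<X> g = Y" "g' \<in> Arr \<X>" "Dom \<X> g' = Y" "Cod \<X> g' = Z"
    and sq: "g \<cdot>\<^bsub>\<X>\<^esub> \<xi> = \<theta> \<cdot>\<^bsub>\<X>\<^esub> T_map f g" and sq': "g' \<cdot>\<^bsub>\<X>\<^esub> \<theta> = \<zeta> \<cdot>\<^bsub>\<X>\<^esub> T_map f' g'"
    using assms by (auto simp: Arr_semidirect_iff)
  note typing = f g algebra_simps[OF alg(1)] algebra_simps[OF alg(2)] algebra_simps[OF alg(3)]
  have "(g' \<cdot>\<^bsub>\<X>\<^esub> g) \<cdot>\<^bsub>\<X>\<^esub> \<xi> = (g' \<cdot>\<^bsub>\<X>\<^esub> \<theta>) \<cdot>\<^bsub>\<X>\<^esub> T_map f g"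
    by (simp add: X.assoc sq typing)
  also have "\<dots> = \<zeta> \<cdot>\<^bsub>\<X>\<^esub> T_map (f' \<cdot>\<^bsub>\<A>\<^esub> f) (g' \<cdot>\<^bsub>\<X>\<^esub> g)"
    by (simp add: sq' X.assoc T_map_Comp typing)
  finally show ?thesis
    using alg by (simp add: Arr_semidirect_iff typing)
qed

lemma category_S: "category S"
proof (rule categoryI, goal_cases)
  case (1 f)
  then show ?case
    by (cases f) (auto simp: Arr_semidirect_iff)
next
  case (2 s)
  then show ?case
    by (cases s) (auto simp: Arr_semidirect_iff algebra_simps)
next
  case (3 f g)
  then show ?case
    by (cases f; cases g) (auto intro: morphism_square_Comp)
next
  case (4 f)
  then show ?case
    by (cases f) (auto simp: Arr_semidirect_iff)
next
  case (5 f g h)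
  then show ?case
    by (cases f; cases g; cases h) (auto simp: Arr_semidirect_iff A.assoc X.assoc)
qed

abbreviation "U \<equiv> forgetful \<A> \<X> T"

lemma forgetful_simps [simp]:
  "algebra (A, X, \<xi>) \<Longrightarrow> fobj U (A, X, \<xi>) = (A, X)"
  "(s, fg, t) \<in> Arr S \<Longrightarrow> farr U (s, fg, t) = fg"
  by (simp_all add: forgetful_def)

lemma is_functor_U: "is_functor S P U"
proof (rule is_functorI, goal_cases)
  case (5 s)
  then show ?case
    by (cases s) (auto simp: Arr_semidirect_iff algebra_simps)
next
  case (6 f)
  then show ?case
    by (cases f) (auto simp: Arr_semidirect_iff algebra_simps)
next
  case (7 f g)
  then show ?case
    by (cases f; cases g) (auto simp: morphism_square_Comp)
qed (simp_all add: category_S category_P, simp_all add: forgetful_def)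

text \<open>The left adjoint of the forgetful functor: the parameter is kept, and \<open>X\<close> goes to the free
  \<open>T\<^sub>A\<close>-algebra on it.\<close>

definition free :: "('ao \<times> 'xo, 'aa \<times> 'xa, 'ao \<times> 'xo \<times> 'xa,
    ('ao \<times> 'xo \<times> 'xa) \<times> ('aa \<times> 'xa) \<times> ('ao \<times> 'xo \<times> 'xa)) func" where
  "free = \<lparr>fobj = (\<lambda>(A, X) \<in> Obj P. (A, T_obj A X, mult A X)),
     farr = (\<lambda>(f, g) \<in> Arr P.
       ((Dom \<A> f, T_obj (Dom \<A> f) (Dom \<X> g), mult (Dom \<A> f) (Dom \<X> g)), (f, T_map f g),
        (Cod \<A> f, T_obj (Cod \<A> f) (Cod \<X> g), mult (Cod \<A> f) (Cod \<X> g))))\<rparr>"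

lemma free_simps [simp]:
  "\<lbrakk>A \<in> Obj \<A>; X \<in> Obj \<X>\<rbrakk> \<Longrightarrow> fobj free (A, X) = (A, T_obj A X, mult A X)"
  "\<lbrakk>f \<in> Arr \<A>; g \<in> Arr \<X>\<rbrakk> \<Longrightarrow> farr free (f, g) =
    ((Dom \<A> f, T_obj (Dom \<A> f) (Dom \<X> g), mult (Dom \<A> f) (Dom \<X> g)), (f, T_map f g),
     (Cod \<A> f, T_obj (Cod \<A> f) (Cod \<X> g), mult (Cod \<A> f) (Cod \<X> g)))"
  by (simp_all add: free_def)

lemma algebra_free [simp]: "\<lbrakk>A \<in> Obj \<A>; X \<in> Obj \<X>\<rbrakk> \<Longrightarrow> algebra (A, T_obj A X, mult A X)"
  by (simp add: algebra_def monad_laws)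

lemma Arr_free [simp]: "\<lbrakk>f \<in> Arr \<A>; g \<in> Arr \<X>\<rbrakk> \<Longrightarrow>
    ((Dom \<A> f, T_obj (Dom \<A> f) (Dom \<X> g), mult (Dom \<A> f) (Dom \<X> g)), (f, T_map f g),
     (Cod \<A> f, T_obj (Cod \<A> f) (Cod \<X> g), mult (Cod \<A> f) (Cod \<X> g))) \<in> Arr S"
  by (simp add: Arr_semidirect_iff T_map_mult)

lemma is_functor_free: "is_functor P S free"
proof (rule is_functorI, goal_cases)
  case (7 f g)
  then show ?case
    by (cases f; cases g) (auto simp: T_map_Comp)
qed (auto simp: category_S category_P, auto simp: free_def)

definition free_unit :: "'ao \<times> 'xo \<Rightarrow> 'aa \<times> 'xa" where
  "free_unit = (\<lambda>(A, X) \<in> Obj P. (Ide \<A> A, unit A X))"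

text \<open>The structure map \<open>\<xi>\<close> as an arrow from the free algebra on \<open>X\<close> over the identity of
  \<open>A\<close>; these arrows are the counit.\<close>

definition structure_map ::
  "'ao \<times> 'xo \<times> 'xa \<Rightarrow> ('ao \<times> 'xo \<times> 'xa) \<times> ('aa \<times> 'xa) \<times> ('ao \<times> 'xo \<times> 'xa)" where
  "structure_map = (\<lambda>(A, X, \<xi>) \<in> Obj S. ((A, T_obj A X, mult A X), (Ide \<A> A, \<xi>), (A, X, \<xi>)))"

lemma free_unit_simps [simp]:
  "\<lbrakk>A \<in> Obj \<A>; X \<in> Obj \<X>\<rbrakk> \<Longrightarrow> free_unit (A, X) = (Ide \<A> A, unit A X)"
  by (simp add: free_unit_def)

lemma structure_map_simps [simp]:
  "algebra (A, X, \<xi>) \<Longrightarrow>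
    structure_map (A, X, \<xi>) = ((A, T_obj A X, mult A X), (Ide \<A> A, \<xi>), (A, X, \<xi>))"
  by (simp add: structure_map_def)

lemma structure_map_in_Arr [simp]:
  assumes "algebra (A, X, \<xi>)"
  shows "((A, T_obj A X, mult A X), (Ide \<A> A, \<xi>), (A, X, \<xi>)) \<in> Arr S"
  using assms algebra_simps[OF assms] by (simp add: Arr_semidirect_iff) (simp add: algebra_def)

text \<open>Naturality of the unit is \<open>T_map_unit\<close>, and naturality of the counit is the square that
  defines the morphisms of \<open>\<A> \<ltimes> \<X>\<close>.  The triangle identities are the unit law of the monad
  \<open>T\<^sub>A\<close> and the unit law of an algebra.\<close>

lemma adjunction_free_forgetful: "adjunction S P free U free_unit structure_map"
  unfolding adjunction_def
proof (intro conjI ballI)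
  show "is_functor P S free" "is_functor S P U"
    by (rule is_functor_free is_functor_U)+
  show "nat_trans P P (id_func P) (comp_func P U free) free_unit"
    unfolding nat_trans_def
  proof (intro conjI ballI)
    show "is_functor P P (id_func P)" "is_functor P P (comp_func P U free)"
      by (intro is_functor_id_func category_P
          is_functor_comp_func[OF is_functor_free is_functor_U])+
    show "free_unit \<in> extensional (Obj P)"
      by (simp add: free_unit_def)
    show "free_unit Z \<in> hom P (fobj (id_func P) Z) (fobj (comp_func P U free) Z)"
      if "Z \<in> Obj P" for Z
      using that by (auto simp: hom_def)
    show "farr (comp_func P U free) f \<cdot>\<^bsub>P\<^esub> free_unit (Dom P f) =
        free_unit (Cod P f) \<cdot>\<^bsub>P\<^esub> farr (id_func P) f" if "f \<in> Arr P" for f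
      using that by (auto simp: T_map_unit)
  qed
  show "nat_trans S S (comp_func S free U) (id_func S) structure_map"
    unfolding nat_trans_def
  proof (intro conjI ballI)
    show "is_functor S S (id_func S)" "is_functor S S (comp_func S free U)"
      by (intro is_functor_id_func category_S
          is_functor_comp_func[OF is_functor_U is_functor_free])+
    show "structure_map \<in> extensional (Obj S)"
      unfolding structure_map_def by (rule restrict_extensional)
    show "structure_map s \<in> hom S (fobj (comp_func S free U) s) (fobj (id_func S) s)"
      if "s \<in> Obj S" for s
      using that by (cases s) (auto simp: hom_def algebra_simps)
    show "farr (id_func S) f \<cdot>\<^bsub>S\<^esub> structure_map (Dom S f) =
        structure_map (Cod S f) \<cdot>\<^bsub>S\<^esub> farr (comp_func S free U) f" if "f \<in> Arr S" for f
      using that by (cases f) (auto simp: Arr_semidirect_iff algebra_simps)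
  qed
  show "structure_map (fobj free Z) \<cdot>\<^bsub>S\<^esub> farr free (free_unit Z) = Ide S (fobj free Z)"
    if "Z \<in> Obj P" for Z
    using that by (auto simp: monad_laws)
  show "farr U (structure_map s) \<cdot>\<^bsub>P\<^esub> free_unit (fobj U s) = Ide P (fobj U s)"
    if "s \<in> Obj S" for s
    using that by (cases s) (auto simp: algebra_simps, simp add: algebra_def)
qed

sublocale adj: adjoint_functors S P free U free_unit structure_map
  by unfold_locales (rule adjunction_free_forgetful)

lemma fobj_comparison:
  "algebra (A, X, \<xi>) \<Longrightarrow> fobj (comparison S U structure_map) (A, X, \<xi>) = ((A, X), (Ide \<A> A, \<xi>))"
  by (simp add: comparison_def)

text \<open>The induced monad is the identity in the first variable, with identity unit.  The unit law
  of an algebra \<open>(a, \<xi>)\<close> therefore forces \<open>a\<close> to be an identity, and an algebra on \<open>(A, X)\<close>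
  is the same thing as a \<open>T\<^sub>A\<close>-algebra on \<open>X\<close>.\<close>

lemma em_algebra_iff:
  "em_algebra P adj.UF_monad (A, X) (a, \<xi>) \<longleftrightarrow> algebra (A, X, \<xi>) \<and> a = Ide \<A> A"
proof
  assume alg: "em_algebra P adj.UF_monad (A, X) (a, \<xi>)"
  then have AX: "A \<in> Obj \<A>" "X \<in> Obj \<X>"
    by (simp_all add: adj.em_algebra_UF_monad_iff)
  then have "a \<in> Arr \<A>" "Dom \<A> a = A" "a \<cdot>\<^bsub>\<A>\<^esub> Ide \<A> A = Ide \<A> A"
    using alg by (simp_all add: adj.em_algebra_UF_monad_iff)
  then have a: "a = Ide \<A> A"
    by simp
  have \<xi>: "\<xi> \<in> Arr \<X>" "Dom \<X> \<xi> = T_obj A X" "Cod \<X> \<xi> = X" "\<xi> \<cdot>\<^bsub>\<X>\<^esub> unit A X = Ide \<X> X"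
    using alg AX by (simp_all add: adj.em_algebra_UF_monad_iff)
  moreover have "\<xi> \<cdot>\<^bsub>\<X>\<^esub> T_arr A \<xi> = \<xi> \<cdot>\<^bsub>\<X>\<^esub> mult A X"
    using alg AX \<xi> Arr_free[of "Ide \<A> A" \<xi>] by (simp add: adj.em_algebra_UF_monad_iff a)
  ultimately show "algebra (A, X, \<xi>) \<and> a = Ide \<A> A"
    using AX a by (simp add: algebra_def)
next
  assume "algebra (A, X, \<xi>) \<and> a = Ide \<A> A"
  then show "em_algebra P adj.UF_monad (A, X) (a, \<xi>)"
    using adj.em_algebra_U_counit[of "(A, X, \<xi>)"] by simp
qed

lemma Arr_em_cat_iff:
  "(((A, X), (a, \<xi>)), (f, g), ((B, Y), (b, \<theta>))) \<in> Arr (em_cat P adj.UF_monad) \<longleftrightarrow>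
    ((A, X, \<xi>), (f, g), (B, Y, \<theta>)) \<in> Arr S \<and> a = Ide \<A> A \<and> b = Ide \<A> B"
  unfolding adj.Arr_em_cat_UF_monad_iff em_algebra_iff Arr_semidirect_iff
  by (auto simp: algebra_simps)

lemma iso_comparison: "is_iso_functor S (em_cat P adj.UF_monad) (comparison S U structure_map)"
  unfolding is_iso_functor_iff_bij_betw[OF adj.is_functor_comparison]
proof
  show "bij_betw (fobj (comparison S U structure_map)) (Obj S) (Obj (em_cat P adj.UF_monad))"
    by (rule bij_betw_byWitness[where f' = "\<lambda>((A, X), (a, \<xi>)). (A, X, \<xi>)"])
      (auto simp: fobj_comparison em_algebra_iff em_cat_def)
  have K: "farr (comparison S U structure_map) ((A, X, \<xi>), fg, (B, Y, \<theta>)) =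
      (((A, X), (Ide \<A> A, \<xi>)), fg, ((B, Y), (Ide \<A> B, \<theta>)))"
    if "((A, X, \<xi>), fg, (B, Y, \<theta>)) \<in> Arr S" for A X \<xi> fg B Y \<theta>
  proof -
    have "algebra (A, X, \<xi>)" "algebra (B, Y, \<theta>)"
      using that by (cases fg; simp add: Arr_semidirect_iff)+
    then show ?thesis
      using that by (simp add: comparison_def)
  qed
  show "bij_betw (farr (comparison S U structure_map)) (Arr S) (Arr (em_cat P adj.UF_monad))"
    by (rule bij_betw_byWitness[where
          f' = "\<lambda>(((A, X), (a, \<xi>)), fg, ((B, Y), (b, \<theta>))). ((A, X, \<xi>), fg, (B, Y, \<theta>))"])
      (auto simp: K Arr_em_cat_iff)
qed

end


section \<open>Monadicity and creation of limits\<close>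

theorem proposition4p1:
  fixes \<A> :: "('ao, 'aa) cat"
    and \<X> :: "('xo, 'xa) cat"
    and T :: "('ao, 'aa, 'xo, 'xa) pmonad"
  assumes "parametrized_monad \<A> \<X> T"
  shows "monadic (semidirect \<A> \<X> T) (prod_cat \<A> \<X>) (forgetful \<A> \<X> T) \<and>
    (\<forall>J :: ('j, 'k) cat. category J \<longrightarrow>
       creates_limits_of_shape J (semidirect \<A> \<X> T) (prod_cat \<A> \<X>) (forgetful \<A> \<X> T))"
proof -
  interpret param_monad \<A> \<X> T
    using assms by unfold_locales
  have "monadic S P U"
    unfolding monadic_def using adjunction_free_forgetful iso_comparison by blast
  then show ?thesis
    using monadic_creates_limits by blast
qed

end
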